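(* Assume the standing hypotheses and the decomposition hypothesis of the context, $\nu_\infty:=\dim H^0_\infty>0$, and one of the following: (a) the strong contraction hypothesis; (b) the weak contraction hypothesis together with $A$ being $C^1$. Let $R>0$ and $h^\infty:B_{H^0_\infty}(\infty,R)\to\bar B_{X^\pm_\infty}(\theta,\rho_A)$ be the number and the (unique) continuous map, existing under these hypotheses for $R$ large, with $(I-P^0_\infty)A(z+h^\infty(z))=0$ for all $z\in B_{H^0_\infty}(\infty,R)$, and let $\mathcal L^\infty(z)=\mathcal L(z+h^\infty(z))$. Then for each critical point $z$ of the function $\mathcal L^\infty:B_{H^0_\infty}(\infty,R)\to\mathbb R$, the point $z+h^\infty(z)$ is a critical point of $\mathcal L$.
   Context: Conventions. $\theta$ is the zero vector. For a normed space $E$ and $R>0$: $B_E(\infty,R)=\{x\in E:\|x\|_E>R\}$; for $r\in(0,\infty]$, $\bar B_E(\theta,r)$ is the closed ball of radius $r$ (the whole space if $r=\infty$). A neighborhood of infinity contains some $B_E(\infty,R)$. A map $f$ on an open set is continuously directional differentiable if $Df(x)(u)=\lim_{t\to0}(f(x+tu)-f(x))/t$ exists for all $x$, $u$ and $x\mapsto Df(x)(u)$ is continuous for each $u$. A critical point of $\mathcal L$ is a point $x$ with $D\mathcal L(x)(u)=0$ for all $u\in H$. (Under the hypotheses of the claim, $\mathcal L^\infty$ is $C^1$.) Standing hypotheses. $H$ is a real Hilbert space with inner product $(\cdot,\cdot)_H$ and norm $\|\cdot\|$; $X$ is a Banach space with norm $\|\cdot\|_X$, $X\subset H$ dense, $\|x\|\le\|x\|_X$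 for $x\in X$. $V_\infty$ is an open neighborhood of infinity in $H$; $V_\infty^X$ is $V_\infty\cap X$ with the topology of $X$. $\mathcal L:V_\infty\to\mathbb R$ is continuous and continuously directional differentiable. There is a continuous and continuously directional differentiable $A:V^X_\infty\to X$ with $D\mathcal L(x)(u)=(A(x),u)_H$ for $x\in V_\infty\cap X$, $u\in X$. There is a map $B:(V_\infty\cap X)\cup\{\infty\}\to L_s(H)$ (bounded self-adjoint operators on $H$) with $B(\infty)(X)\subset X$ and $(DA(x)(u),v)_H=(B(x)u,v)_H$ for $x\in V_\infty\cap X$, $u,v\in X$. Either $0\notin\sigma(B(\infty))$ or $0$ is an isolated point of $\sigma(B(\infty))$. If $u\in H$ and $B(\infty)u\in X$, then $u\in X$. Decomposition hypothesis. $B(x)=P(x)+Q(x)$ for $x\in(V_\infty\cap X)\cup\{\infty\}$ with $P(x):H\to H$ positive definite linear and $Q(x):H\to H$ compact linear, such that: all eigenfunctions of $B(\infty)$ with negative eigenvalues lie in $X$; for every sequence $\{x_k\}\subset V_\infty\cap X$ with $\|x_k\|\to\infty$, $\|P(x_k)u-P(\infty)u\|\to0$ for all $u\in H$; $\|Q(x)-Q(\infty)\|_{L(H)}\to0$ as $x\in V_\infty\cap X$, $\|x\|\to\infty$; for every sequence $\{x_n\}\subset V_\infty\cap X$ with $\|x_n\|\to\infty$ there are $C_0>0$, $n_0$ with $(P(x_n)u,u)_H\ge C_0\|u\|^2$ for all $u\in H$, $n\ge n_0$. Notation. $H^0_\infty=\mathrm{Ker}\,B(\infty)$ (contained in $X$),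 $H^\pm_\infty=(H^0_\infty)^\perp$. $P^0_\infty$ is the orthogonal projection onto $H^0_\infty$. $X^\pm_\infty=H^\pm_\infty\cap X$ with norm $\|\cdot\|_X$. $B_{H^0_\infty}(\infty,R)$ is taken with respect to $\|\cdot\|$. $B(\infty)|_{X^\pm_\infty}$ is a Banach isomorphism of $X^\pm_\infty$, and $C_1^\infty$ is the $L(X^\pm_\infty)$-norm of its inverse. $M(A)=\lim_{R\to\infty}\sup\{\|(I-P^0_\infty)A(z)\|_X: z\in H^0_\infty,\|z\|_X\ge R\}$. Put $N(z,x)=(I-P^0_\infty)A(z+x)-B(\infty)x$ for $z\in H^0_\infty$, $x\in X^\pm_\infty$. ($R_1$ below is always large enough that $z+x\in V_\infty\cap X$.) Weak contraction hypothesis. There are $R_1>0$, $\kappa>1$ and $\rho_A$ such that $\|N(z,x_1)-N(z,x_2)\|_X\le\frac1{\kappa C_1^\infty}\|x_1-x_2\|_X$ for all $x_1,x_2\in X^\pm_\infty$ with $\|x_i\|_X<\rho_A$ and all $z\in H^0_\infty$ with $\|z\|\ge R_1$; here either $M(A)<\infty$ and $\rho_A\in(\frac{\kappa}{\kappa-1}C_1^\infty M(A),\infty)$, or $\rho_A=\infty$ (in which case $M(A)<\infty$ is not required). Strong contraction hypothesis. The same, with the inequality replaced by $\|N(z_1,x_1)-N(z_2,x_2)\|_X\le\frac1{\kappa C_1^\infty}\|z_1+x_1-z_2-x_2\|_X$ for all such $x_i$ and all $z_1,z_2\in H^0_\infty$ with $\|z_i\|\ge R_1$. *)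

theory Defs
  imports "HOL-Analysis.Analysis"
begin

text \<open>
  The Hilbert space \<open>H\<close> is a type \<open>'h\<close> of sort \<open>{real_inner, banach}\<close>, the Banach space \<open>X\<close> a
  type \<open>'x\<close> of sort \<open>banach\<close> (with its own norm), and the inclusion of \<open>X\<close> in \<open>H\<close> is an injection
  \<open>e :: 'x \<Rightarrow> 'h\<close>.  Thus \<open>u \<in> X\<close> reads \<open>u \<in> range e\<close>, a vector \<open>u \<in> H\<close> lying in \<open>X\<close> is the point
  \<open>inv e u\<close> of \<open>'x\<close>, and \<open>V \<inter> X\<close> with the topology of \<open>X\<close> is \<open>e -` V\<close>.
  A family indexed by \<open>(V \<inter> X) \<union> {\<infinity>}\<close> is a function on \<open>'x\<close> together with its value at infinity
  (\<open>Binf\<close>, \<open>Pinf\<close>, \<open>Qinf\<close>).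
\<close>

section \<open>Directional derivatives and critical points\<close>

definition has_dir_deriv ::
    "('a::real_normed_vector \<Rightarrow> 'b::real_normed_vector) \<Rightarrow> 'a \<Rightarrow> 'a \<Rightarrow> 'b \<Rightarrow> bool" where
  "has_dir_deriv f x u d \<longleftrightarrow> ((\<lambda>t::real. (f (x + t *\<^sub>R u) - f x) /\<^sub>R t) \<longlongrightarrow> d) (at 0)"

definition dir_deriv ::
    "('a::real_normed_vector \<Rightarrow> 'b::real_normed_vector) \<Rightarrow> 'a \<Rightarrow> 'a \<Rightarrow> 'b" where
  "dir_deriv f x u = (THE d. has_dir_deriv f x u d)"

definition cont_dir_differentiable_on ::
    "'a set \<Rightarrow> ('a::real_normed_vector \<Rightarrow> 'b::real_normed_vector) \<Rightarrow> bool" where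
  "cont_dir_differentiable_on U f \<longleftrightarrow>
     (\<forall>x\<in>U. \<forall>u. \<exists>d. has_dir_deriv f x u d) \<and>
     (\<forall>u. continuous_on U (\<lambda>x. dir_deriv f x u))"

definition C1_on ::
    "'a set \<Rightarrow> ('a::real_normed_vector \<Rightarrow> 'b::real_normed_vector) \<Rightarrow> bool" where
  "C1_on U f \<longleftrightarrow>
     (\<exists>f' :: 'a \<Rightarrow> 'a \<Rightarrow>\<^sub>L 'b.
        (\<forall>x\<in>U. (f has_derivative blinfun_apply (f' x)) (at x)) \<and> continuous_on U f')"

text \<open>
  \<open>E\<close> is the linear space on (an open subset of) which \<open>f\<close> is regarded: \<open>UNIV\<close> for the functional
  on \<open>H\<close>, the kernel of \<open>B(\<infinity>)\<close> for the reduced functional.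
\<close>
definition critical_point ::
    "'a set \<Rightarrow> ('a::real_normed_vector \<Rightarrow> real) \<Rightarrow> 'a \<Rightarrow> bool" where
  "critical_point E f x \<longleftrightarrow> (\<forall>u\<in>E. has_dir_deriv f x u 0)"

section \<open>Operators on a real Hilbert space\<close>

definition self_adjoint :: "('h::real_inner \<Rightarrow>\<^sub>L 'h) \<Rightarrow> bool" where
  "self_adjoint T \<longleftrightarrow> (\<forall>u v. inner (T u) v = inner u (T v))"

definition positive_definite :: "('h::real_inner \<Rightarrow>\<^sub>L 'h) \<Rightarrow> bool" where
  "positive_definite T \<longleftrightarrow> (\<forall>u. u \<noteq> 0 \<longrightarrow> 0 < inner (T u) u)"

definition compact_operator :: "('a::real_normed_vector \<Rightarrow>\<^sub>L 'b::real_normed_vector) \<Rightarrow> bool" where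
  "compact_operator T \<longleftrightarrow> (\<forall>S. bounded S \<longrightarrow> compact (closure (blinfun_apply T ` S)))"

text \<open>The real spectrum; for self-adjoint operators this is the whole spectrum.\<close>
definition spectrum :: "('h::real_normed_vector \<Rightarrow>\<^sub>L 'h) \<Rightarrow> real set" where
  "spectrum T =
     {l. \<not> (\<exists>S. S o\<^sub>L (T - l *\<^sub>R id_blinfun) = id_blinfun \<and>
                (T - l *\<^sub>R id_blinfun) o\<^sub>L S = id_blinfun)}"

definition orth_proj :: "'h::real_inner set \<Rightarrow> 'h \<Rightarrow> 'h" where
  "orth_proj S u = (THE p. p \<in> S \<and> u - p \<in> orthogonal_comp S)"

section \<open>Standing hypotheses\<close>

definition standing_hypotheses ::
    "('x::banach \<Rightarrow> 'h::{real_inner,banach}) \<Rightarrow> 'h set \<Rightarrow> ('h \<Rightarrow> real) \<Rightarrow> ('x \<Rightarrow> 'x) \<Rightarrow>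
     ('x \<Rightarrow> 'h \<Rightarrow>\<^sub>L 'h) \<Rightarrow> ('h \<Rightarrow>\<^sub>L 'h) \<Rightarrow> bool" where
  "standing_hypotheses e V L A B Binf \<longleftrightarrow>
     linear e \<and> inj e \<and> closure (range e) = UNIV \<and> (\<forall>x. norm (e x) \<le> norm x) \<and>
     open V \<and> (\<exists>R>0. {u. norm u > R} \<subseteq> V) \<and>
     continuous_on V L \<and> cont_dir_differentiable_on V L \<and>
     continuous_on (e -` V) A \<and> cont_dir_differentiable_on (e -` V) A \<and>
     (\<forall>x\<in>e -` V. \<forall>u. dir_deriv L (e x) (e u) = inner (e (A x)) (e u)) \<and>
     (\<forall>x\<in>e -` V. self_adjoint (B x)) \<and> self_adjoint Binf \<and>
     blinfun_apply Binf ` range e \<subseteq> range e \<and>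
     (\<forall>x\<in>e -` V. \<forall>u v. inner (e (dir_deriv A x u)) (e v) = inner (B x (e u)) (e v)) \<and>
     (0 \<notin> spectrum Binf \<or> 0 isolated_in spectrum Binf) \<and>
     (\<forall>u. Binf u \<in> range e \<longrightarrow> u \<in> range e)"

text \<open>
  The summands are typed as bounded operators: \<open>Q(x)\<close> is bounded because it is compact, hence so
  is \<open>P(x) = B(x) - Q(x)\<close>.
\<close>
definition decomposition_hypothesis ::
    "('x::banach \<Rightarrow> 'h::{real_inner,banach}) \<Rightarrow> 'h set \<Rightarrow> ('x \<Rightarrow> 'h \<Rightarrow>\<^sub>L 'h) \<Rightarrow> ('h \<Rightarrow>\<^sub>L 'h) \<Rightarrow>
     ('x \<Rightarrow> 'h \<Rightarrow>\<^sub>L 'h) \<Rightarrow> ('h \<Rightarrow>\<^sub>L 'h) \<Rightarrow> ('x \<Rightarrow> 'h \<Rightarrow>\<^sub>L 'h) \<Rightarrow> ('h \<Rightarrow>\<^sub>L 'h) \<Rightarrow> bool" where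
  "decomposition_hypothesis e V B Binf P Pinf Q Qinf \<longleftrightarrow>
     (\<forall>x\<in>e -` V. B x = P x + Q x \<and> positive_definite (P x) \<and> compact_operator (Q x)) \<and>
     Binf = Pinf + Qinf \<and> positive_definite Pinf \<and> compact_operator Qinf \<and>
     (\<forall>l u. l < 0 \<and> u \<noteq> 0 \<and> Binf u = l *\<^sub>R u \<longrightarrow> u \<in> range e) \<and>
     (\<forall>xs :: nat \<Rightarrow> 'x. range xs \<subseteq> e -` V \<and>
        filterlim (\<lambda>k. norm (e (xs k))) at_top sequentially \<longrightarrow>
        (\<forall>u. (\<lambda>k. norm (P (xs k) u - Pinf u)) \<longlonglongrightarrow> 0)) \<and>
     (\<forall>\<epsilon>>0. \<exists>R. \<forall>x\<in>e -` V. norm (e x) > R \<longrightarrow> norm (Q x - Qinf) < \<epsilon>) \<and>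
     (\<forall>xs :: nat \<Rightarrow> 'x. range xs \<subseteq> e -` V \<and>
        filterlim (\<lambda>k. norm (e (xs k))) at_top sequentially \<longrightarrow>
        (\<exists>C\<^sub>0>0. \<exists>n\<^sub>0. \<forall>n\<ge>n\<^sub>0. \<forall>u. inner (P (xs n) u) u \<ge> C\<^sub>0 * (norm u)\<^sup>2))"

section \<open>The splitting at infinity\<close>

definition H0 :: "('h::real_inner \<Rightarrow>\<^sub>L 'h) \<Rightarrow> 'h set" where
  "H0 Binf = {u. Binf u = 0}"

definition ball_infty :: "('h::real_inner \<Rightarrow>\<^sub>L 'h) \<Rightarrow> real \<Rightarrow> 'h set" where
  "ball_infty Binf R = {z \<in> H0 Binf. norm z > R}"

definition Xpm :: "('x \<Rightarrow> 'h::real_inner) \<Rightarrow> ('h \<Rightarrow>\<^sub>L 'h) \<Rightarrow> 'x set" where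
  "Xpm e Binf = e -` orthogonal_comp (H0 Binf)"

text \<open>\<open>I - P\<^sup>0\<close> and \<open>B(\<infinity>)\<close> as maps of \<open>X\<close> into itself (note that \<open>H0 \<subseteq> X\<close>).\<close>

definition ImP0 :: "('x::banach \<Rightarrow> 'h::{real_inner,banach}) \<Rightarrow> ('h \<Rightarrow>\<^sub>L 'h) \<Rightarrow> 'x \<Rightarrow> 'x" where
  "ImP0 e Binf x = x - inv e (orth_proj (H0 Binf) (e x))"

definition B_X :: "('x::banach \<Rightarrow> 'h::{real_inner,banach}) \<Rightarrow> ('h \<Rightarrow>\<^sub>L 'h) \<Rightarrow> 'x \<Rightarrow> 'x" where
  "B_X e Binf x = inv e (Binf (e x))"

definition onorm_on ::
    "'a::real_normed_vector set \<Rightarrow> ('a \<Rightarrow> 'b::real_normed_vector) \<Rightarrow> real" where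
  "onorm_on S f = (SUP x\<in>S. norm (f x) / norm x)"

definition C1_infty :: "('x::banach \<Rightarrow> 'h::{real_inner,banach}) \<Rightarrow> ('h \<Rightarrow>\<^sub>L 'h) \<Rightarrow> real" where
  "C1_infty e Binf = onorm_on (Xpm e Binf) (the_inv_into (Xpm e Binf) (B_X e Binf))"

definition M_A ::
    "('x::banach \<Rightarrow> 'h::{real_inner,banach}) \<Rightarrow> ('h \<Rightarrow>\<^sub>L 'h) \<Rightarrow> ('x \<Rightarrow> 'x) \<Rightarrow> ereal" where
  "M_A e Binf A =
     Lim at_top (\<lambda>R::real. SUP z\<in>{z \<in> H0 Binf. norm (inv e z) \<ge> R}.
                    ereal (norm (ImP0 e Binf (A (inv e z)))))"

definition N_map ::
    "('x::banach \<Rightarrow> 'h::{real_inner,banach}) \<Rightarrow> ('h \<Rightarrow>\<^sub>L 'h) \<Rightarrow> ('x \<Rightarrow> 'x) \<Rightarrow> 'h \<Rightarrow> 'x \<Rightarrow> 'x" where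
  "N_map e Binf A z x = ImP0 e Binf (A (inv e z + x)) - B_X e Binf x"

section \<open>Contraction hypotheses\<close>

definition admissible_constants ::
    "('x::banach \<Rightarrow> 'h::{real_inner,banach}) \<Rightarrow> 'h set \<Rightarrow> ('x \<Rightarrow> 'x) \<Rightarrow> ('h \<Rightarrow>\<^sub>L 'h) \<Rightarrow>
     real \<Rightarrow> real \<Rightarrow> ereal \<Rightarrow> bool" where
  "admissible_constants e V A Binf R1 \<kappa> \<rho> \<longleftrightarrow>
     R1 > 0 \<and> \<kappa> > 1 \<and>
     (M_A e Binf A < \<infinity> \<and> ereal (\<kappa> / (\<kappa> - 1) * C1_infty e Binf) * M_A e Binf A < \<rho> \<and> \<rho> < \<infinity> \<or>
      \<rho> = \<infinity>) \<and>
     (\<forall>z\<in>H0 Binf. \<forall>x\<in>Xpm e Binf. norm z \<ge> R1 \<and> ereal (norm x) \<le> \<rho> \<longrightarrow> z + e x \<in> V)"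

text \<open>
  If \<open>Xpm = {0}\<close> then \<open>C1_infty = 0\<close>; both inequalities below then hold trivially, since
  \<open>N_map\<close> vanishes.
\<close>
definition weak_contraction ::
    "('x::banach \<Rightarrow> 'h::{real_inner,banach}) \<Rightarrow> 'h set \<Rightarrow> ('x \<Rightarrow> 'x) \<Rightarrow> ('h \<Rightarrow>\<^sub>L 'h) \<Rightarrow>
     real \<Rightarrow> real \<Rightarrow> ereal \<Rightarrow> bool" where
  "weak_contraction e V A Binf R1 \<kappa> \<rho> \<longleftrightarrow>
     admissible_constants e V A Binf R1 \<kappa> \<rho> \<and>
     (\<forall>z\<in>H0 Binf. \<forall>x\<^sub>1\<in>Xpm e Binf. \<forall>x\<^sub>2\<in>Xpm e Binf.
        norm z \<ge> R1 \<and> ereal (norm x\<^sub>1) < \<rho> \<and> ereal (norm x\<^sub>2) < \<rho> \<longrightarrow>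
        norm (N_map e Binf A z x\<^sub>1 - N_map e Binf A z x\<^sub>2)
          \<le> 1 / (\<kappa> * C1_infty e Binf) * norm (x\<^sub>1 - x\<^sub>2))"

definition strong_contraction ::
    "('x::banach \<Rightarrow> 'h::{real_inner,banach}) \<Rightarrow> 'h set \<Rightarrow> ('x \<Rightarrow> 'x) \<Rightarrow> ('h \<Rightarrow>\<^sub>L 'h) \<Rightarrow>
     real \<Rightarrow> real \<Rightarrow> ereal \<Rightarrow> bool" where
  "strong_contraction e V A Binf R1 \<kappa> \<rho> \<longleftrightarrow>
     admissible_constants e V A Binf R1 \<kappa> \<rho> \<and>
     (\<forall>z\<^sub>1\<in>H0 Binf. \<forall>z\<^sub>2\<in>H0 Binf. \<forall>x\<^sub>1\<in>Xpm e Binf. \<forall>x\<^sub>2\<in>Xpm e Binf.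
        norm z\<^sub>1 \<ge> R1 \<and> norm z\<^sub>2 \<ge> R1 \<and> ereal (norm x\<^sub>1) < \<rho> \<and> ereal (norm x\<^sub>2) < \<rho> \<longrightarrow>
        norm (N_map e Binf A z\<^sub>1 x\<^sub>1 - N_map e Binf A z\<^sub>2 x\<^sub>2)
          \<le> 1 / (\<kappa> * C1_infty e Binf) * norm (inv e z\<^sub>1 + x\<^sub>1 - inv e z\<^sub>2 - x\<^sub>2))"

section \<open>The reduction map and the reduced functional\<close>

definition reduction_map ::
    "('x::banach \<Rightarrow> 'h::{real_inner,banach}) \<Rightarrow> ('x \<Rightarrow> 'x) \<Rightarrow> ('h \<Rightarrow>\<^sub>L 'h) \<Rightarrow>
     ereal \<Rightarrow> real \<Rightarrow> ('h \<Rightarrow> 'x) \<Rightarrow> bool" where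
  "reduction_map e A Binf \<rho> R h \<longleftrightarrow>
     continuous_on (ball_infty Binf R) h \<and>
     (\<forall>z\<in>ball_infty Binf R. h z \<in> Xpm e Binf \<and> ereal (norm (h z)) \<le> \<rho> \<and>
        ImP0 e Binf (A (inv e z + h z)) = 0)"

definition L_infty :: "('x \<Rightarrow> 'h::real_inner) \<Rightarrow> ('h \<Rightarrow> real) \<Rightarrow> ('h \<Rightarrow> 'x) \<Rightarrow> 'h \<Rightarrow> real" where
  "L_infty e L h z = L (z + e (h z))"

end

theory Submission
  imports Defs
begin

text \<open>
  Write \<open>x\<close> for the component in \<open>X\<^sup>\<plusminus>\<close> and \<open>z\<close> for the one in the kernel \<open>H\<^sup>0\<close> of \<open>B(\<infinity>)\<close>.  The equation
  \<open>(I - P\<^sup>0) A(z + x) = 0\<close> reads \<open>B(\<infinity>) x = - N(z, x)\<close>.  Once \<open>B(\<infinity>)\<close> is known to be invertible on \<open>X\<^sup>\<plusminus>\<close>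
  with inverse of norm \<open>C\<^sub>1\<close>, the right-hand side becomes a contraction with factor \<open>1 / \<kappa>\<close>, and
  Banach's fixed point theorem produces the reduction map.  Invertibility on \<open>H\<^sup>\<plusminus>\<close> follows from the
  splitting of \<open>B(\<infinity>)\<close> into a coercive and a compact part together with self-adjointness
  (\<open>Binf_surj_orth\<close>); it passes to \<open>X\<^sup>\<plusminus>\<close> by the regularity assumption on \<open>B(\<infinity>)\<close>, and the inverse is
  bounded there by the closed graph theorem (\<open>bounded_linear_B_X_inv_ImP0\<close>).

  The strong contraction inequality contains the weak one as its case \<open>z\<^sub>1 = z\<^sub>2\<close>.
  Comparing solutions over two points \<open>z\<close> and \<open>z'\<close> (\<open>reduced_solution_stability\<close>) yields uniqueness,
  continuity, and, since \<open>A\<close> has directional derivatives, a Lipschitz bound for \<open>h\<close> along lines.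
  That bound suffices to compute the derivative of the reduced functional along \<open>H\<^sup>0\<close>, which is
  \<open>u \<mapsto> (A(z + h(z)), u)\<close> (\<open>L_infty_has_dir_deriv\<close>).  At a critical point the choice \<open>u = A(z + h(z)) \<in> H\<^sup>0\<close> gives \<open>A(z + h(z)) = 0\<close>, so the derivative of \<open>L\<close> vanishes in all
  directions of \<open>X\<close>.  These are dense in \<open>H\<close>, and a Baire category argument
  (\<open>dir_deriv_zero_if_zero_on_dense\<close>) extends this to every direction.
\<close>

section \<open>Consequences of the Baire category theorem\<close>

lemma Baire_closed_cover:
  fixes F :: "nat \<Rightarrow> 'a::complete_space set"
  assumes closed: "\<And>n. closed (F n)" and cover: "(\<Union>n. F n) = UNIV"
  obtains n a r where "r > 0" "ball a r \<subseteq> F n"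
proof -
  have "\<exists>n. interior (F n) \<noteq> {}"
  proof (rule ccontr)
    assume "\<not> (\<exists>n. interior (F n) \<noteq> {})"
    then have "interior (\<Union>(range F)) = {}"
      using Met_TC.metric_Baire_category_alt[where ?'a = 'a, of "range F"] closed complete_UNIV
      by auto
    with cover show False by simp
  qed
  then obtain n a where "a \<in> interior (F n)" by auto
  then obtain r where "r > 0" "ball a r \<subseteq> F n" by (auto simp: mem_interior)
  then show ?thesis using that by blast
qed

text \<open>
  Closed graph theorem.  By Baire, the closure of some sublevel set of \<open>norm (T x)\<close> contains a
  ball, so every \<open>y\<close> is approximated to within half its norm by a vector whose image is controlled
  by \<open>norm y\<close>.  Iterating on the remainder writes \<open>y\<close> as a series whose images converge absolutely,
  and closedness of the graph identifies their sum with \<open>T y\<close>.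
\<close>
lemma closed_graph_bounded_linear:
  fixes T :: "'a::banach \<Rightarrow> 'b::banach"
  assumes lin: "linear T"
    and graph: "\<And>x l w. x \<longlonglongrightarrow> l \<Longrightarrow> (\<lambda>n::nat. T (x n)) \<longlonglongrightarrow> w \<Longrightarrow> T l = w"
  shows "bounded_linear T"
proof -
  interpret T: linear T by fact
  define E where "E n = {x. norm (T x) \<le> real n}" for n
  have "(\<Union>n. closure (E n)) = UNIV"
  proof -
    have "x \<in> (\<Union>n. closure (E n))" for x
      using real_arch_simple[of "norm (T x)"] closure_subset by (fastforce simp: E_def)
    then show ?thesis by auto
  qed
  then obtain n a r where r: "r > 0" "ball a r \<subseteq> closure (E n)"
    using Baire_closed_cover[of "\<lambda>n. closure (E n)"] closed_closure by metis
  define M where "M = 2 * real n + 1"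
  have M: "M > 0" by (simp add: M_def)
  have appr0: "\<exists>v. norm (T v) \<le> M \<and> norm (y - v) < \<epsilon>" if y: "norm y < r" and \<epsilon>: "\<epsilon> > 0" for y \<epsilon>
  proof -
    have "a + y \<in> closure (E n)" "a \<in> closure (E n)"
      using r y by (auto simp: subset_iff dist_norm)
    then obtain v1 v2 where v: "v1 \<in> E n" "v2 \<in> E n" "dist v1 (a + y) < \<epsilon>/2" "dist v2 a < \<epsilon>/2"
      using \<epsilon> by (meson closure_approachable half_gt_zero)
    have "norm (T (v1 - v2)) \<le> M"
      using v(1,2) norm_triangle_ineq4[of "T v1" "T v2"] by (auto simp: E_def M_def T.diff)
    moreover have "norm (y - (v1 - v2)) \<le> norm (v1 - (a + y)) + norm (v2 - a)"
      using norm_triangle_ineq4[of "v2 - a" "v1 - (a + y)"] by (simp add: algebra_simps)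
    ultimately show ?thesis using v(3,4) by (force simp: dist_norm)
  qed
  define K where "K = 2 * M / r"
  have K: "K > 0" using M r by (simp add: K_def)
  have "\<exists>v. norm (T v) \<le> K * norm y \<and> norm (y - v) \<le> norm y / 2" for y
  proof (cases "y = 0")
    case True
    then show ?thesis by (intro exI[of _ 0]) (simp add: T.zero)
  next
    case False
    define c where "c = r / (2 * norm y)"
    have c: "c > 0" using False r by (simp add: c_def)
    have "norm (c *\<^sub>R y) < r" using False r by (simp add: c_def)
    from appr0[OF this, of "c * (norm y / 2)"] False c
    obtain v where v: "norm (T v) \<le> M" "norm (c *\<^sub>R y - v) < c * (norm y / 2)" by auto
    have "norm (T ((1/c) *\<^sub>R v)) = norm (T v) / c"
      using c by (simp add: T.scale)
    also have "\<dots> \<le> M / c" using v(1) c by (simp add: divide_right_mono)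
    also have "\<dots> = K * norm y" using False by (simp add: c_def K_def)
    finally have 1: "norm (T ((1/c) *\<^sub>R v)) \<le> K * norm y" .
    have "c * norm (y - (1/c) *\<^sub>R v) = norm (c *\<^sub>R (y - (1/c) *\<^sub>R v))" using c by simp
    also have "\<dots> = norm (c *\<^sub>R y - v)" using c by (simp add: scaleR_diff_right)
    also have "\<dots> \<le> c * (norm y / 2)" using v(2) by simp
    finally have 2: "norm (y - (1/c) *\<^sub>R v) \<le> norm y / 2" using c by simp
    show ?thesis using 1 2 by blast
  qed
  then obtain \<phi> where \<phi>: "\<And>y. norm (T (\<phi> y)) \<le> K * norm y" "\<And>y. norm (y - \<phi> y) \<le> norm y / 2"
    by metis
  have "norm (T y) \<le> 2 * K * norm y" for y
  proof -
    define \<rho> where "\<rho> k = ((\<lambda>y. y - \<phi> y) ^^ k) y" for k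
    have \<rho>0: "\<rho> 0 = y" and \<rho>S: "\<rho> (Suc k) = \<rho> k - \<phi> (\<rho> k)" for k by (auto simp: \<rho>_def)
    have \<rho>n: "norm (\<rho> k) \<le> norm y * (1/2) ^ k" for k
    proof (induction k)
      case (Suc k)
      then show ?case using \<phi>(2)[of "\<rho> k"] by (simp add: \<rho>S)
    qed (simp add: \<rho>0)
    have part: "(\<Sum>k<m. \<phi> (\<rho> k)) = y - \<rho> m" for m
      by (induction m) (auto simp: \<rho>0 \<rho>S)
    have "\<rho> \<longlonglongrightarrow> 0"
    proof (rule Lim_null_comparison)
      show "\<forall>\<^sub>F k in sequentially. norm (\<rho> k) \<le> norm y * (1/2) ^ k" using \<rho>n by simp
      show "(\<lambda>k. norm y * (1/2) ^ k) \<longlonglongrightarrow> 0"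
        by (intro tendsto_mult_right_zero LIMSEQ_power_zero) simp
    qed
    then have lim1: "(\<lambda>m. \<Sum>k<m. \<phi> (\<rho> k)) \<longlonglongrightarrow> y"
      using tendsto_diff[OF tendsto_const, of \<rho> 0 sequentially y] by (simp add: part)
    have bnd: "norm (T (\<phi> (\<rho> k))) \<le> (K * norm y) * (1/2) ^ k" for k
    proof -
      have "norm (T (\<phi> (\<rho> k))) \<le> K * norm (\<rho> k)" by (rule \<phi>)
      also have "\<dots> \<le> K * (norm y * (1/2) ^ k)" using \<rho>n K by (intro mult_left_mono) auto
      finally show ?thesis by simp
    qed
    have geo: "(\<lambda>k. (K * norm y) * (1/2) ^ k) sums (K * norm y * 2)"
      using sums_mult[OF geometric_sums[of "1/2::real"], of "K * norm y"] by simp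
    have sm: "summable (\<lambda>k. norm (T (\<phi> (\<rho> k))))"
      using bnd by (intro summable_comparison_test'[OF sums_summable[OF geo], of 0]) auto
    have lim2: "(\<lambda>m. T (\<Sum>k<m. \<phi> (\<rho> k))) \<longlonglongrightarrow> (\<Sum>k. T (\<phi> (\<rho> k)))"
      unfolding T.sum using summable_norm_cancel[OF sm] by (rule summable_LIMSEQ)
    have "T y = (\<Sum>k. T (\<phi> (\<rho> k)))" by (rule graph[OF lim1 lim2])
    then have "norm (T y) \<le> (\<Sum>k. norm (T (\<phi> (\<rho> k))))" using summable_norm[OF sm] by simp
    also have "\<dots> \<le> (\<Sum>k. (K * norm y) * (1/2) ^ k)"
      by (rule suminf_le[OF bnd sm sums_summable[OF geo]])
    also have "\<dots> = 2 * K * norm y" using sums_unique[OF geo] by simp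
    finally show ?thesis .
  qed
  then show ?thesis
    by (intro bounded_linear_intro[where K = "2 * K"]) (auto simp: T.add T.scale mult.commute)
qed

section \<open>Directional derivatives\<close>

lemma dir_deriv_eq:
  assumes "has_dir_deriv f x u d" shows "dir_deriv f x u = d"
  using assms unfolding dir_deriv_def has_dir_deriv_def
  by (intro the_equality) (auto intro: tendsto_unique[OF trivial_limit_at])

lemma has_dir_deriv_dir_deriv:
  assumes "cont_dir_differentiable_on U f" "x \<in> U"
  shows "has_dir_deriv f x u (dir_deriv f x u)"
  using assms dir_deriv_eq unfolding cont_dir_differentiable_on_def by metis

lemma has_dir_deriv_scaleR:
  assumes "has_dir_deriv f x u d"
  shows "has_dir_deriv f x (c *\<^sub>R u) (c *\<^sub>R d)"
proof (cases "c = 0")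
  case True
  then show ?thesis by (simp add: has_dir_deriv_def)
next
  case False
  have "filterlim (\<lambda>t::real. t * c) (at 0) (at 0)"
    using False by (auto intro!: filterlim_atI tendsto_eq_intros simp: eventually_at_filter)
  from filterlim_compose[OF assms[unfolded has_dir_deriv_def] this]
  have "((\<lambda>t. c *\<^sub>R ((f (x + (t * c) *\<^sub>R u) - f x) /\<^sub>R (t * c))) \<longlongrightarrow> c *\<^sub>R d) (at 0)"
    by (intro tendsto_intros)
  then show ?thesis unfolding has_dir_deriv_def using False by (simp add: field_simps)
qed

lemma dir_deriv_scaleR:
  assumes "cont_dir_differentiable_on U f" "x \<in> U"
  shows "dir_deriv f x (c *\<^sub>R u) = c *\<^sub>R dir_deriv f x u"
  by (intro dir_deriv_eq has_dir_deriv_scaleR has_dir_deriv_dir_deriv[OF assms])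

lemma dir_deriv_mean_value:
  fixes f :: "'a::real_normed_vector \<Rightarrow> real"
  assumes diff: "\<And>s. 0 \<le> s \<Longrightarrow> s \<le> 1 \<Longrightarrow> has_dir_deriv f (x + s *\<^sub>R u) u (g s)"
  shows "\<exists>s. 0 < s \<and> s < 1 \<and> f (x + u) - f x = g s"
proof -
  have "((\<lambda>s. f (x + s *\<^sub>R u)) has_real_derivative g s) (at s)" if "0 \<le> s" "s \<le> 1" for s
    using diff[OF that] unfolding has_dir_deriv_def DERIV_def
    by (simp add: scaleR_left_distrib add.assoc divide_inverse mult.commute)
  from MVT2[of 0 1, OF _ this] show ?thesis by auto
qed

text \<open>
  Gateaux derivatives need not be additive; continuity of \<open>x \<mapsto> Df(x)(v)\<close> forces it, because by the
  mean value theorem the increment of \<open>f\<close> from \<open>x + t u\<close> to \<open>x + t u + t v\<close> is \<open>t\<close> times a derivative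
  in direction \<open>v\<close> at a point tending to \<open>x\<close>.
\<close>
lemma dir_deriv_add:
  fixes f :: "'a::real_normed_vector \<Rightarrow> real"
  assumes U: "open U" "x \<in> U" and f: "cont_dir_differentiable_on U f"
  shows "dir_deriv f x (u + v) = dir_deriv f x u + dir_deriv f x v"
proof -
  obtain r where r: "r > 0" "ball x r \<subseteq> U" using U by (auto simp: open_contains_ball)
  define \<delta> where "\<delta> = r / (norm u + norm v + 1)"
  have \<delta>: "\<delta> > 0" using r by (auto simp: \<delta>_def intro!: divide_pos_pos add_nonneg_pos)
  have in_U: "x + t *\<^sub>R u + (s * t) *\<^sub>R v \<in> U" if "\<bar>t\<bar> < \<delta>" "0 \<le> s" "s \<le> 1" for s t
  proof -
    have "norm (t *\<^sub>R u + (s * t) *\<^sub>R v) \<le> \<bar>t\<bar> * norm u + \<bar>s * t\<bar> * norm v"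
      by (metis norm_scaleR norm_triangle_ineq)
    also have "\<dots> \<le> \<bar>t\<bar> * norm u + \<bar>t\<bar> * norm v"
      using that by (intro add_left_mono mult_right_mono) (auto simp: abs_mult mult_left_le_one_le)
    also have "\<dots> \<le> \<bar>t\<bar> * (norm u + norm v + 1)" by (simp add: algebra_simps)
    also have "\<dots> < r"
    proof -
      have "norm u + norm v + 1 > 0" by (simp add: add_nonneg_pos)
      then show ?thesis using that(1) by (simp add: \<delta>_def pos_less_divide_eq)
    qed
    finally have "x + t *\<^sub>R u + (s * t) *\<^sub>R v \<in> ball x r"
      by (metis add.assoc add_diff_cancel_left' dist_commute dist_norm mem_ball)
    then show ?thesis using r by blast
  qed
  have "\<exists>s. 0 < s \<and> s < 1 \<and>
          f (x + t *\<^sub>R u + t *\<^sub>R v) - f (x + t *\<^sub>R u) = t * dir_deriv f (x + t *\<^sub>R u + (s * t) *\<^sub>R v) v"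
    if "\<bar>t\<bar> < \<delta>" for t
    using in_U[OF that] has_dir_deriv_scaleR[OF has_dir_deriv_dir_deriv[OF f]]
    by (intro dir_deriv_mean_value) (simp add: has_dir_deriv_scaleR[of _ _ v _ t])
  then obtain \<sigma> where \<sigma>: "\<And>t. \<bar>t\<bar> < \<delta> \<Longrightarrow> 0 < \<sigma> t \<and> \<sigma> t < 1 \<and>
      f (x + t *\<^sub>R u + t *\<^sub>R v) - f (x + t *\<^sub>R u) = t * dir_deriv f (x + t *\<^sub>R u + (\<sigma> t * t) *\<^sub>R v) v"
    by metis
  have ev: "\<forall>\<^sub>F t in at 0. \<bar>t\<bar> < \<delta> \<and> t \<noteq> (0::real)"
    using \<delta> by (auto simp: eventually_at intro!: exI[of _ \<delta>])
  have "((\<lambda>t. \<sigma> t * t) \<longlongrightarrow> 0) (at 0)"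
  proof (rule Lim_null_comparison)
    show "\<forall>\<^sub>F t in at 0. norm (\<sigma> t * t) \<le> \<bar>t\<bar>"
      using ev by eventually_elim (use \<sigma> in \<open>force simp: abs_mult mult_left_le_one_le\<close>)
    show "((\<lambda>t::real. \<bar>t\<bar>) \<longlongrightarrow> 0) (at 0)" by (auto intro!: tendsto_eq_intros)
  qed
  then have lim: "((\<lambda>t. x + t *\<^sub>R u + (\<sigma> t * t) *\<^sub>R v) \<longlongrightarrow> x) (at 0)"
    using tendsto_add[OF tendsto_add[OF tendsto_const tendsto_scaleR[OF tendsto_ident_at tendsto_const]]
        tendsto_scaleR[OF _ tendsto_const], of "\<lambda>t. \<sigma> t * t" 0 0 UNIV x u v] by simp
  have "continuous (at x) (\<lambda>y. dir_deriv f y v)"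
    using f U continuous_on_eq_continuous_at[OF U(1)] unfolding cont_dir_differentiable_on_def by blast
  then have l1: "((\<lambda>t. dir_deriv f (x + t *\<^sub>R u + (\<sigma> t * t) *\<^sub>R v) v) \<longlongrightarrow> dir_deriv f x v) (at 0)"
    using lim by (rule continuous_within_tendsto_compose'[of _ UNIV, simplified])
  have l2: "((\<lambda>t. (f (x + t *\<^sub>R u) - f x) /\<^sub>R t) \<longlongrightarrow> dir_deriv f x u) (at 0)"
    using has_dir_deriv_dir_deriv[OF f U(2)] by (simp add: has_dir_deriv_def)
  have "((\<lambda>t. (f (x + t *\<^sub>R (u + v)) - f x) /\<^sub>R t) \<longlongrightarrow> dir_deriv f x u + dir_deriv f x v) (at 0)"
  proof (rule Lim_transform_eventually[OF tendsto_add[OF l2 l1]])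
    show "\<forall>\<^sub>F t in at 0. (f (x + t *\<^sub>R u) - f x) /\<^sub>R t + dir_deriv f (x + t *\<^sub>R u + (\<sigma> t * t) *\<^sub>R v) v
        = (f (x + t *\<^sub>R (u + v)) - f x) /\<^sub>R t"
      using ev
    proof eventually_elim
      case (elim t)
      then have "f (x + t *\<^sub>R (u + v)) =
          f (x + t *\<^sub>R u) + t * dir_deriv f (x + t *\<^sub>R u + (\<sigma> t * t) *\<^sub>R v) v"
        using \<sigma>[of t] by (simp add: scaleR_add_right add.assoc)
      then show ?case using elim by (simp add: field_simps)
    qed
  qed
  then show ?thesis by (intro dir_deriv_eq) (simp add: has_dir_deriv_def)
qed

text \<open>
  A continuous directional derivative is not assumed continuous in the direction, so vanishing on a
  dense set does not immediately spread.  It is however a pointwise limit of the continuous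
  difference quotients \<open>q n\<close>, and Baire bounds it on some ball \<open>ball a r\<close>.  Every multiple \<open>c u\<close>
  can be moved into that ball by subtracting an element of the dense set, which does not change the
  value; so \<open>\<bar>c\<bar> \<bar>Df(x)(u)\<bar>\<close> is bounded independently of \<open>c\<close>.
\<close>
lemma dir_deriv_zero_if_zero_on_dense:
  fixes f :: "'a::banach \<Rightarrow> real"
  assumes U: "open U" "x \<in> U" and contf: "continuous_on U f" and f: "cont_dir_differentiable_on U f"
    and dense: "closure D = UNIV" and zero: "\<And>w. w \<in> D \<Longrightarrow> dir_deriv f x w = 0"
  shows "dir_deriv f x u = 0"
proof -
  define q where "q n u = real (Suc n) * (f (x + (1 / real (Suc n)) *\<^sub>R u) - f x)" for n u
  define F where "F N = {u. \<forall>n\<ge>N. x + (1 / real (Suc n)) *\<^sub>R u \<in> U \<longrightarrow> \<bar>q n u\<bar> \<le> real N}" for N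
  have q_lim: "(\<lambda>n. q n u) \<longlonglongrightarrow> dir_deriv f x u" for u
  proof -
    have *: "filterlim (\<lambda>n. 1 / real (Suc n)) (at 0) sequentially"
      by (intro filterlim_atI LIMSEQ_Suc[OF lim_1_over_n]) auto
    from filterlim_compose[OF has_dir_deriv_dir_deriv[OF f U(2), unfolded has_dir_deriv_def] *]
    show ?thesis by (simp add: q_def)
  qed
  have "closed (F N)" for N
  proof -
    have "open {u. x + (1 / real (Suc n)) *\<^sub>R u \<in> U \<and> \<bar>q n u\<bar> > real N}" for n
    proof -
      let ?W = "(\<lambda>u. x + (1 / real (Suc n)) *\<^sub>R u) -` U"
      have W: "open ?W" by (intro open_vimage U continuous_intros)
      have "continuous_on ?W (\<lambda>u. \<bar>q n u\<bar>)"
        unfolding q_def by (intro continuous_intros continuous_on_compose2[OF contf]) auto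
      then have "open (?W \<inter> (\<lambda>u. \<bar>q n u\<bar>) -` {real N<..})"
        using W by (intro continuous_open_preimage) auto
      then show ?thesis by (simp add: vimage_def Int_def conj_commute)
    qed
    then have "open (\<Union>n\<in>{N..}. {u. x + (1 / real (Suc n)) *\<^sub>R u \<in> U \<and> \<bar>q n u\<bar> > real N})" by blast
    moreover have "- F N = (\<Union>n\<in>{N..}. {u. x + (1 / real (Suc n)) *\<^sub>R u \<in> U \<and> \<bar>q n u\<bar> > real N})"
      by (auto simp: F_def not_le)
    ultimately show ?thesis by (simp add: closed_def)
  qed
  moreover have "(\<Union>N. F N) = UNIV"
  proof -
    have "v \<in> (\<Union>N. F N)" for v
    proof -
      obtain c where c: "\<And>n. \<bar>q n v\<bar> \<le> c"
        using convergent_imp_Bseq[of "\<lambda>n. q n v"] q_lim[of v] by (auto simp: convergent_def Bseq_def)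
      obtain N where "c \<le> real N" using real_arch_simple by blast
      then have "v \<in> F N" using order_trans[OF c] by (simp add: F_def)
      then show ?thesis by blast
    qed
    then show ?thesis by blast
  qed
  ultimately obtain N a r where r: "r > 0" "ball a r \<subseteq> F N"
    by (rule Baire_closed_cover)
  have bnd: "\<bar>dir_deriv f x v\<bar> \<le> real N" if "v \<in> ball a r" for v
  proof (rule tendsto_upperbound[OF tendsto_rabs[OF q_lim]])
    have "(\<lambda>n. x + (1 / real (Suc n)) *\<^sub>R v) \<longlonglongrightarrow> x + 0 *\<^sub>R v"
      by (intro tendsto_intros LIMSEQ_Suc[OF lim_1_over_n])
    then have "\<forall>\<^sub>F n in sequentially. x + (1 / real (Suc n)) *\<^sub>R v \<in> U"
      using topological_tendstoD[OF _ U(1)] U(2) by (metis add_0_right scaleR_zero_left)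
    then show "\<forall>\<^sub>F n in sequentially. \<bar>q n v\<bar> \<le> real N"
      using eventually_ge_at_top[of N] by eventually_elim (use r that in \<open>auto simp: F_def\<close>)
  qed simp
  have "\<bar>c\<bar> * \<bar>dir_deriv f x u\<bar> \<le> real N" for c
  proof -
    obtain w where w: "w \<in> D" "dist w (c *\<^sub>R u - a) < r"
      using dense r(1) by (metis UNIV_I closure_approachable)
    have "c *\<^sub>R u - w \<in> ball a r"
      using w(2) by (simp add: dist_norm norm_minus_commute algebra_simps)
    moreover have "dir_deriv f x (c *\<^sub>R u - w) = c * dir_deriv f x u"
      using dir_deriv_add[OF U f, of "c *\<^sub>R u" "(-1) *\<^sub>R w"] zero[OF w(1)]
      by (simp only: dir_deriv_scaleR[OF f U(2)]) simp
    ultimately show ?thesis using bnd by (metis abs_mult)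
  qed
  from this[of "(real N + 1) / dir_deriv f x u"] show ?thesis
    by (cases "dir_deriv f x u = 0") (auto simp: abs_divide)
qed

section \<open>Linear algebra and self-adjoint operators in a Hilbert space\<close>

lemma orth_proj_eqI:
  assumes S: "subspace S" and p: "p \<in> S" "u - p \<in> orthogonal_comp S"
  shows "orth_proj S u = p"
  unfolding orth_proj_def
proof (rule the_equality)
  fix q assume q: "q \<in> S \<and> u - q \<in> orthogonal_comp S"
  have "(u - p) - (u - q) \<in> orthogonal_comp S"
    using q p subspace_diff[OF subspace_orthogonal_comp] by blast
  moreover have "q - p \<in> S" using q p subspace_diff[OF S] by blast
  ultimately have "inner (q - p) (q - p) = 0"
    by (auto simp: orthogonal_comp_def orthogonal_def)
  then show "q = p" by simp
qed (use p in auto)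

text \<open>
  Gram--Schmidt turns \<open>B\<close> into a pairwise orthogonal \<open>C\<close>, for which the projection is the familiar
  Fourier sum.  A zero vector in \<open>C\<close> does no harm: its coefficient is \<open>0 / 0 = 0\<close>.
\<close>
lemma orth_proj_span_finite:
  fixes B :: "'h::real_inner set"
  assumes "finite B"
  obtains C where "finite C" "span C = span B"
    "\<And>u. orth_proj (span B) u = (\<Sum>c\<in>C. (inner u c / inner c c) *\<^sub>R c)"
    "\<And>u. orth_proj (span B) u \<in> span B"
    "\<And>u. u - orth_proj (span B) u \<in> orthogonal_comp (span B)"
proof -
  obtain C where C: "finite C" "span C = span B" "pairwise orthogonal C"
    using basis_orthogonal[OF assms] by blast
  define p where "p u = (\<Sum>c\<in>C. (inner u c / inner c c) *\<^sub>R c)" for u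
  have mem: "p u \<in> span C" for u
    unfolding p_def by (intro span_sum span_scale span_base)
  have "inner (p u) c = inner u c" if c: "c \<in> C" for u c
  proof -
    have "inner (p u) c = (\<Sum>d\<in>C. if d = c then inner u c else 0)"
      unfolding p_def inner_sum_left
    proof (rule sum.cong)
      fix d assume "d \<in> C"
      then show "inner ((inner u d / inner d d) *\<^sub>R d) c = (if d = c then inner u c else 0)"
        using C(3) c by (auto simp: pairwise_def orthogonal_def)
    qed simp
    then show ?thesis using C(1) c by simp
  qed
  then have "orthogonal (u - p u) c" if "c \<in> C" for u c
    using that by (simp add: orthogonal_def inner_diff_left)
  then have orth: "u - p u \<in> orthogonal_comp (span C)" for u
    using orthogonal_to_span[of _ C "u - p u"] by (auto simp: orthogonal_comp_def orthogonal_commute)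
  have "orth_proj (span B) u = p u" for u
    using orth_proj_eqI[OF subspace_span mem orth] C(2) by simp
  then show ?thesis using that[OF C(1,2)] mem orth C(2) by (simp add: p_def)
qed

lemma closed_orthogonal_comp: "closed (orthogonal_comp (W :: 'h::real_inner set))"
proof -
  have "orthogonal_comp W = (\<Inter>y\<in>W. {x. inner y x = 0})"
    by (auto simp: orthogonal_comp_def orthogonal_def)
  moreover have "closed {x. inner y x = 0}" for y :: 'h
    by (intro closed_Collect_eq continuous_intros)
  ultimately show ?thesis by auto
qed

text \<open>
  If unit vectors \<open>v\<^sub>n\<close> of \<open>S\<close> satisfied \<open>T v\<^sub>n \<rightarrow> 0\<close>, then along a subsequence \<open>Q v\<^sub>n\<close> and hence
  \<open>P v\<^sub>n\<close> would converge; coercivity of \<open>P\<close> then makes \<open>v\<^sub>n\<close> itself converge, to a unit vector of \<open>S\<close> in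
  the kernel of \<open>T\<close>.
\<close>
lemma coercive_plus_compact_bounded_below:
  fixes T P Q :: "'h::{real_inner,banach} \<Rightarrow>\<^sub>L 'h"
  assumes T: "T = P + Q" and c: "c > 0" "\<And>u. inner (P u) u \<ge> c * (norm u)\<^sup>2"
    and Q: "compact_operator Q"
    and S: "subspace S" "closed S" and inj: "\<And>u. u \<in> S \<Longrightarrow> T u = 0 \<Longrightarrow> u = 0"
  shows "\<exists>d>0. \<forall>u\<in>S. d * norm u \<le> norm (T u)"
proof (rule ccontr)
  assume neg: "\<not> ?thesis"
  have "\<exists>v\<in>S. norm v = 1 \<and> norm (T v) < 1 / real (Suc n)" for n
  proof -
    obtain u where u: "u \<in> S" "norm (T u) < 1 / real (Suc n) * norm u"
      using neg by (metis not_le of_nat_0_less_iff zero_less_Suc zero_less_divide_1_iff)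
    then have "u \<noteq> 0" by auto
    then have "norm (T (u /\<^sub>R norm u)) < 1 / real (Suc n)"
      using u(2) by (simp add: blinfun.scaleR_right field_simps)
    then show ?thesis
      using u(1) \<open>u \<noteq> 0\<close> S(1) by (intro bexI[of _ "u /\<^sub>R norm u"]) (auto intro: subspace_scale)
  qed
  then obtain v where v: "\<And>n. v n \<in> S" "\<And>n. norm (v n) = 1" "\<And>n. norm (T (v n)) < 1 / real (Suc n)"
    by metis
  have Tv: "(\<lambda>n. T (v n)) \<longlonglongrightarrow> 0"
    by (rule Lim_null_comparison[OF always_eventually LIMSEQ_Suc[OF lim_1_over_n]])
      (use v(3) less_imp_le in blast)
  have "compact (closure (Q ` cball 0 1))"
    using Q bounded_cball unfolding compact_operator_def by blast
  moreover have "Q (v n) \<in> closure (Q ` cball 0 1)" for n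
    by (intro subsetD[OF closure_subset] imageI) (simp add: v(2))
  ultimately obtain q r where r: "strict_mono (r :: nat \<Rightarrow> nat)" "((\<lambda>n. Q (v n)) \<circ> r) \<longlonglongrightarrow> q"
    unfolding compact_def by metis
  have "(\<lambda>n. T (v (r n)) - Q (v (r n))) \<longlonglongrightarrow> 0 - q"
    using LIMSEQ_subseq_LIMSEQ[OF Tv r(1)] r(2) by (intro tendsto_diff) (auto simp: o_def)
  then have "(\<lambda>n. P (v (r n))) \<longlonglongrightarrow> - q" by (simp add: T blinfun.add_left)
  then have Pc: "Cauchy (\<lambda>n. P (v (r n)))" by (rule LIMSEQ_imp_Cauchy)
  have Pb: "c * norm u \<le> norm (P u)" for u
  proof (cases "u = 0")
    case False
    have "c * norm u * norm u \<le> norm (P u) * norm u"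
      using order_trans[OF c(2) norm_cauchy_schwarz, of u] by (simp add: power2_eq_square mult.assoc)
    then show ?thesis using False by simp
  qed simp
  have "Cauchy (\<lambda>n. v (r n))"
  proof (rule metric_CauchyI)
    fix \<epsilon> :: real assume "\<epsilon> > 0"
    then obtain M where M: "\<And>m n. m \<ge> M \<Longrightarrow> n \<ge> M \<Longrightarrow> dist (P (v (r m))) (P (v (r n))) < c * \<epsilon>"
      using metric_CauchyD[OF Pc, of "c * \<epsilon>"] c(1) by auto
    have "dist (v (r m)) (v (r n)) < \<epsilon>" if "m \<ge> M" "n \<ge> M" for m n
    proof -
      have "c * dist (v (r m)) (v (r n)) \<le> dist (P (v (r m))) (P (v (r n)))"
        using Pb[of "v (r m) - v (r n)"] by (simp add: dist_norm blinfun.diff_right)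
      then have "c * dist (v (r m)) (v (r n)) < c * \<epsilon>" using M[OF that] by linarith
      then show ?thesis using c(1) by simp
    qed
    then show "\<exists>M. \<forall>m\<ge>M. \<forall>n\<ge>M. dist (v (r m)) (v (r n)) < \<epsilon>" by blast
  qed
  then obtain w where w: "(\<lambda>n. v (r n)) \<longlonglongrightarrow> w" using Cauchy_convergent convergent_def by blast
  have "w \<in> S" using closed_sequentially[OF S(2) _ w] v(1) by blast
  moreover have "norm w = 1"
    using LIMSEQ_unique[OF tendsto_norm[OF w]] v(2) by simp
  moreover have "T w = 0"
    using LIMSEQ_unique[OF blinfun.tendsto[OF tendsto_const w, of T] LIMSEQ_subseq_LIMSEQ[OF Tv r(1), unfolded o_def]] .
  ultimately show False using inj[of w] by auto
qed

text \<open>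
  On \<open>S\<close> the square \<open>T\<^sup>2\<close> is symmetric and coercive, \<open>(T\<^sup>2 u, u) = \<parallel>T u\<parallel>\<^sup>2 \<ge> d\<^sup>2 \<parallel>u\<parallel>\<^sup>2\<close>.  Hence
  \<open>T\<^sup>2 x = y\<close> is solvable by the Lax--Milgram iteration \<open>x \<mapsto> x - \<tau> (T\<^sup>2 x - y)\<close>, a contraction for
  small \<open>\<tau>\<close>, and \<open>T x\<close> is a preimage of \<open>y\<close>.
\<close>
lemma self_adjoint_bounded_below_surj:
  fixes T :: "'h::{real_inner,banach} \<Rightarrow>\<^sub>L 'h"
  assumes T: "self_adjoint T" and S: "subspace S" "closed S" and inv: "T ` S \<subseteq> S"
    and d: "d > 0" "\<And>u. u \<in> S \<Longrightarrow> d * norm u \<le> norm (T u)" and y: "y \<in> S"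
  shows "\<exists>x\<in>S. T x = y"
proof -
  define M where "M = (norm T)\<^sup>2 + d\<^sup>2"
  have M: "M > 0" "d\<^sup>2 \<le> M" using d(1) by (auto simp: M_def add_nonneg_pos)
  \<comment> \<open>\<open>\<tau>\<close> minimises \<open>1 - 2 \<tau> d\<^sup>2 + \<tau>\<^sup>2 M\<^sup>2\<close>, which bounds the square of the contraction factor;
    \<open>M\<close> dominates both \<open>\<parallel>T\<^sup>2\<parallel>\<close> and \<open>d\<^sup>2\<close>, so that the minimum \<open>k\<close> lies in \<open>[0, 1)\<close>.\<close>
  define \<tau> where "\<tau> = d\<^sup>2 / M\<^sup>2"
  define k where "k = 1 - (d\<^sup>2 / M)\<^sup>2"
  have "(d\<^sup>2 / M)\<^sup>2 \<le> 1" using M by (simp add: power_le_one)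
  moreover have "(d\<^sup>2 / M)\<^sup>2 > 0" using d(1) M by simp
  ultimately have k: "0 \<le> k" "k < 1" by (auto simp: k_def)
  have TS: "T u \<in> S" if "u \<in> S" for u using inv that by blast
  have est: "norm (u - \<tau> *\<^sub>R T (T u)) \<le> sqrt k * norm u" if u: "u \<in> S" for u
  proof -
    have "norm (T (T u)) \<le> norm T * (norm T * norm u)"
      by (meson norm_blinfun order_trans mult_left_mono norm_ge_zero)
    also have "\<dots> \<le> M * norm u" using d(1) by (simp add: M_def power2_eq_square distrib_right mult.assoc)
    finally have 1: "(norm (T (T u)))\<^sup>2 \<le> M\<^sup>2 * (norm u)\<^sup>2"
      by (metis norm_ge_zero power_mono power_mult_distrib)
    have 2: "inner u (T (T u)) = (norm (T u))\<^sup>2"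
      using T by (metis power2_norm_eq_inner self_adjoint_def)
    have 3: "d\<^sup>2 * (norm u)\<^sup>2 \<le> (norm (T u))\<^sup>2"
      using d(1) power_mono[OF d(2)[OF u], of 2] by (simp add: power_mult_distrib)
    have \<tau>: "\<tau> \<ge> 0" by (simp add: \<tau>_def)
    have "(norm (u - \<tau> *\<^sub>R T (T u)))\<^sup>2
        = (norm u)\<^sup>2 - 2 * \<tau> * (norm (T u))\<^sup>2 + \<tau>\<^sup>2 * (norm (T (T u)))\<^sup>2"
      unfolding power2_norm_eq_inner 2[unfolded power2_norm_eq_inner, symmetric]
      by (simp add: inner_diff inner_commute power2_eq_square algebra_simps)
    also have "\<dots> \<le> (norm u)\<^sup>2 - 2 * \<tau> * (d\<^sup>2 * (norm u)\<^sup>2) + \<tau>\<^sup>2 * (M\<^sup>2 * (norm u)\<^sup>2)"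
      using 1 3 \<tau> by (intro add_mono diff_mono mult_left_mono) auto
    also have "\<dots> = k * (norm u)\<^sup>2"
      using M(1) by (simp add: \<tau>_def k_def field_simps power2_eq_square)
    also have "\<dots> = (sqrt k * norm u)\<^sup>2" using k by (simp add: power_mult_distrib)
    finally show ?thesis using k by (simp add: power2_le_iff_abs_le)
  qed
  have "\<exists>!x\<in>S. x - \<tau> *\<^sub>R (T (T x) - y) = x"
  proof (rule Banach_fix[where c = "sqrt k"])
    show "complete S" "S \<noteq> {}" using S subspace_0 by (auto simp: complete_eq_closed)
    show "0 \<le> sqrt k" "sqrt k < 1" using k by auto
    show "(\<lambda>x. x - \<tau> *\<^sub>R (T (T x) - y)) ` S \<subseteq> S"
      using S(1) TS y by (auto intro!: subspace_diff subspace_scale)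
    fix a b assume "a \<in> S" "b \<in> S"
    then have "a - b \<in> S" using S(1) by (rule subspace_diff[rotated])
    from est[OF this]
    show "dist (a - \<tau> *\<^sub>R (T (T a) - y)) (b - \<tau> *\<^sub>R (T (T b) - y)) \<le> sqrt k * dist a b"
      by (simp add: dist_norm blinfun.diff_right algebra_simps)
  qed
  moreover have "\<tau> \<noteq> 0" using d(1) M by (simp add: \<tau>_def)
  ultimately obtain x where "x \<in> S" "T (T x) = y" by auto
  then show ?thesis using TS by blast
qed

section \<open>The splitting at infinity\<close>

locale splitting_at_infinity =
  fixes e :: "'x::banach \<Rightarrow> 'h::{real_inner,banach}" and V :: "'h set" and L :: "'h \<Rightarrow> real"
    and A :: "'x \<Rightarrow> 'x" and B P Q :: "'x \<Rightarrow> 'h \<Rightarrow>\<^sub>L 'h" and Binf Pinf Qinf :: "'h \<Rightarrow>\<^sub>L 'h"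
  assumes standing: "standing_hypotheses e V L A B Binf"
    and decomposition: "decomposition_hypothesis e V B Binf P Pinf Q Qinf"
    and dim_H0_pos: "dim (H0 Binf) > 0"
begin

lemma linear_e: "linear e" and inj_e: "inj e" and dense_e: "closure (range e) = UNIV"
  and norm_e_le: "norm (e x) \<le> norm x" and open_V: "open V"
  and V_neighborhood: "\<exists>R>0. {u. norm u > R} \<subseteq> V"
  and continuous_L: "continuous_on V L" and diff_L: "cont_dir_differentiable_on V L"
  and continuous_A: "continuous_on (e -` V) A" and diff_A: "cont_dir_differentiable_on (e -` V) A"
  and gradient: "e x \<in> V \<Longrightarrow> dir_deriv L (e x) (e w) = inner (e (A x)) (e w)"
  and self_adjoint_Binf: "self_adjoint Binf"
  and Binf_range_e: "Binf (e x) \<in> range e"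
  and range_e_if_Binf: "Binf u \<in> range e \<Longrightarrow> u \<in> range e"
  using standing unfolding standing_hypotheses_def by blast+

lemma bounded_linear_e: "bounded_linear e"
  using linear_e norm_e_le
  by (intro bounded_linear_intro[where K = 1]) (auto simp: linear_add linear_scale)

sublocale e: bounded_linear e by (rule bounded_linear_e)

lemma e_eq_iff [simp]: "e x = e y \<longleftrightarrow> x = y"
  using inj_e by (auto simp: inj_def)

lemma inv_e_e [simp]: "inv e (e x) = x"
  using inj_e by simp

lemma e_inv_e: "u \<in> range e \<Longrightarrow> e (inv e u) = u"
  by (rule f_inv_into_f)

lemma open_eV: "open (e -` V)"
  by (intro open_vimage open_V e.continuous_on continuous_on_id)

lemma subspace_H0: "subspace (H0 Binf)"
  by (auto simp: H0_def subspace_def blinfun.add_right blinfun.scaleR_right)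

lemma H0_range_e: "z \<in> H0 Binf \<Longrightarrow> z \<in> range e"
  using range_e_if_Binf[of z] e.zero by (metis (mono_tags, lifting) H0_def mem_Collect_eq rangeI)

text \<open>
  The orthogonal projection \<open>P\<^sup>0\<close> as a map from \<open>H\<close> to \<open>X\<close>.  On the kernel \<open>H\<^sup>0\<close> it inverts the
  embedding \<open>e\<close>, and unlike \<open>inv e\<close> it is linear and continuous on all of \<open>H\<close>.
\<close>
definition P0_X :: "'h \<Rightarrow> 'x" where "P0_X u = inv e (orth_proj (H0 Binf) u)"

text \<open>
  A positive dimension entails a finite basis, since \<open>dim\<close> is \<open>0\<close> for infinite-dimensional spaces.
  Continuity of the projection into the stronger norm of \<open>X\<close> comes from its finite rank: only the
  finitely many basis vectors have to be moved to \<open>X\<close>.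
\<close>
lemma
  shows orth_proj_H0: "orth_proj (H0 Binf) u \<in> H0 Binf"
    and orth_proj_H0_orth: "u - orth_proj (H0 Binf) u \<in> orthogonal_comp (H0 Binf)"
    and bounded_linear_P0_X: "bounded_linear P0_X"
proof -
  obtain D where D: "D \<subseteq> H0 Binf" "H0 Binf \<subseteq> span D" "card D = dim (H0 Binf)"
    using basis_exists[of "H0 Binf"] by metis
  have fin: "finite D" using D(3) dim_H0_pos by (auto intro: card_ge_0_finite)
  have span: "span D = H0 Binf"
    using D span_minimal[OF D(1) subspace_H0] by blast
  obtain C where C: "finite C" "span C = H0 Binf"
      "\<And>u. orth_proj (H0 Binf) u = (\<Sum>c\<in>C. (inner u c / inner c c) *\<^sub>R c)"
      "\<And>u. orth_proj (H0 Binf) u \<in> H0 Binf"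
      "\<And>u. u - orth_proj (H0 Binf) u \<in> orthogonal_comp (H0 Binf)"
    using orth_proj_span_finite[OF fin, unfolded span] by metis
  show "orth_proj (H0 Binf) u \<in> H0 Binf" "u - orth_proj (H0 Binf) u \<in> orthogonal_comp (H0 Binf)"
    using C by auto
  have eJ: "e (P0_X u) = orth_proj (H0 Binf) u" for u
    unfolding P0_X_def using C(4) by (intro e_inv_e H0_range_e)
  have eC: "e (inv e c) = c" if "c \<in> C" for c
    using that C(2) by (intro e_inv_e H0_range_e) (auto intro: span_base)
  have "e (P0_X u) = e (\<Sum>c\<in>C. (inner u c / inner c c) *\<^sub>R inv e c)" for u
    by (simp add: eJ C(3) e.sum e.scaleR eC)
  then have P0_X: "P0_X = (\<lambda>u. \<Sum>c\<in>C. (inner u c / inner c c) *\<^sub>R inv e c)" by auto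
  have "bounded_linear (\<lambda>u. (inner u c / inner c c) *\<^sub>R inv e c)" for c
    by (intro bounded_linear_scaleR_const bounded_linear_compose[OF bounded_linear_divide bounded_linear_inner_left])
  then show "bounded_linear P0_X" unfolding P0_X by (intro bounded_linear_sum)
qed

sublocale P0_X: bounded_linear P0_X by (rule bounded_linear_P0_X)

lemma e_P0_X: "e (P0_X u) = orth_proj (H0 Binf) u"
  unfolding P0_X_def by (intro e_inv_e H0_range_e orth_proj_H0)

lemma e_P0_X_H0: "e (P0_X u) \<in> H0 Binf"
  by (simp add: e_P0_X orth_proj_H0)

lemma orth_proj_H0_id: "z \<in> H0 Binf \<Longrightarrow> orth_proj (H0 Binf) z = z"
  using subspace_0[OF subspace_orthogonal_comp] by (intro orth_proj_eqI subspace_H0) auto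

lemma inv_e_H0: "z \<in> H0 Binf \<Longrightarrow> inv e z = P0_X z"
  by (simp add: P0_X_def orth_proj_H0_id)

lemma e_P0_X_id: "z \<in> H0 Binf \<Longrightarrow> e (P0_X z) = z"
  by (simp add: e_P0_X orth_proj_H0_id)

lemma inner_H0_Xpm: "z \<in> H0 Binf \<Longrightarrow> x \<in> Xpm e Binf \<Longrightarrow> inner z (e x) = 0"
  by (auto simp: Xpm_def orthogonal_comp_def orthogonal_def)

lemma subspace_Xpm: "subspace (Xpm e Binf)"
  using subspace_orthogonal_comp[of "H0 Binf"]
  by (auto simp: Xpm_def subspace_def e.zero e.add e.scaleR)

lemma closed_Xpm: "closed (Xpm e Binf)"
  unfolding Xpm_def
  by (intro closed_vimage closed_orthogonal_comp e.continuous_on continuous_on_id)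

lemma ImP0_eq: "ImP0 e Binf x = x - P0_X (e x)"
  by (simp add: ImP0_def P0_X_def)

lemma bounded_linear_ImP0: "bounded_linear (ImP0 e Binf)"
  unfolding ImP0_eq[abs_def]
  by (intro bounded_linear_sub bounded_linear_ident bounded_linear_compose[OF bounded_linear_P0_X bounded_linear_e])

sublocale ImP0: bounded_linear "ImP0 e Binf" by (rule bounded_linear_ImP0)

lemma ImP0_Xpm: "ImP0 e Binf x \<in> Xpm e Binf"
  using orth_proj_H0_orth by (simp add: Xpm_def ImP0_eq e.diff e_P0_X)

lemma ImP0_id: "x \<in> Xpm e Binf \<Longrightarrow> ImP0 e Binf x = x"
  using orth_proj_eqI[OF subspace_H0 subspace_0[OF subspace_H0], of "e x"]
  by (simp add: ImP0_eq P0_X_def Xpm_def) (metis e.zero inv_e_e)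

lemma ImP0_eq_0_iff: "ImP0 e Binf x = 0 \<longleftrightarrow> e x \<in> H0 Binf"
  using e_P0_X_H0[of "e x"] inv_e_H0[of "e x"] by (auto simp: ImP0_eq)

lemma e_B_X: "e (B_X e Binf x) = Binf (e x)"
  unfolding B_X_def by (intro e_inv_e Binf_range_e)

lemma linear_B_X: "linear (B_X e Binf)"
proof (rule linearI)
  fix x y and c :: real
  have "e (B_X e Binf (x + y)) = e (B_X e Binf x + B_X e Binf y)"
    by (simp only: e_B_X e.add blinfun.add_right)
  then show "B_X e Binf (x + y) = B_X e Binf x + B_X e Binf y" by simp
  have "e (B_X e Binf (c *\<^sub>R x)) = e (c *\<^sub>R B_X e Binf x)"
    by (simp only: e_B_X e.scaleR blinfun.scaleR_right)
  then show "B_X e Binf (c *\<^sub>R x) = c *\<^sub>R B_X e Binf x" by simp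
qed

sublocale B_X: linear "B_X e Binf" by (rule linear_B_X)

lemma Binf_orth: "Binf u \<in> orthogonal_comp (H0 Binf)"
  using self_adjoint_Binf
  by (auto simp: orthogonal_comp_def orthogonal_def self_adjoint_def H0_def) (metis inner_zero_left)

lemma B_X_Xpm: "B_X e Binf x \<in> Xpm e Binf"
  by (simp add: Xpm_def e_B_X Binf_orth)

lemma H0_orth_trivial: "u \<in> orthogonal_comp (H0 Binf) \<Longrightarrow> Binf u = 0 \<Longrightarrow> u = 0"
  by (auto simp: orthogonal_comp_def orthogonal_def H0_def)

lemma H0_nontrivial: "\<exists>z\<in>H0 Binf. z \<noteq> 0"
proof (rule ccontr)
  assume "\<not> ?thesis"
  then have "H0 Binf = {0}" using subspace_0[OF subspace_H0] by auto
  then have "dim (H0 Binf) = 0" using dim_span_eq_card_independent[of "{} :: 'h set"]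
    by (simp add: independent_empty)
  with dim_H0_pos show False by simp
qed

lemma Binf_decomposition: "Binf = Pinf + Qinf" and compact_Qinf: "compact_operator Qinf"
  and P_tendsto: "range xs \<subseteq> e -` V \<Longrightarrow> filterlim (\<lambda>k. norm (e (xs k))) at_top sequentially \<Longrightarrow>
    (\<lambda>k. norm (P (xs k) u - Pinf u)) \<longlonglongrightarrow> 0"
  and P_coercive: "range xs \<subseteq> e -` V \<Longrightarrow> filterlim (\<lambda>k. norm (e (xs k))) at_top sequentially \<Longrightarrow>
    \<exists>c>0. \<exists>n0. \<forall>n\<ge>n0. \<forall>u. inner (P (xs n) u) u \<ge> c * (norm u)\<^sup>2"
  using decomposition unfolding decomposition_hypothesis_def by simp_all

text \<open>
  Positive definiteness alone is not a uniform lower bound.  It is inherited from the uniform bound on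
  \<open>P(x\<^sub>n)\<close> by strong convergence; multiples of a nonzero vector of the kernel provide a sequence
  \<open>x\<^sub>n\<close> going to infinity.
\<close>
lemma Pinf_coercive: "\<exists>c>0. \<forall>u. inner (Pinf u) u \<ge> c * (norm u)\<^sup>2"
proof -
  obtain z where z: "z \<in> H0 Binf" "z \<noteq> 0" using H0_nontrivial by blast
  obtain R where R: "R > 0" "{u. norm u > R} \<subseteq> V" using V_neighborhood by blast
  define xs where "xs n = (real n + (R + 1) / norm z) *\<^sub>R P0_X z" for n
  have norm_xs: "norm (e (xs n)) = real n * norm z + R + 1" for n
  proof -
    have "norm (e (xs n)) = \<bar>real n + (R + 1) / norm z\<bar> * norm z"
      by (simp add: xs_def e.scaleR e_P0_X_id[OF z(1)])
    also have "\<bar>real n + (R + 1) / norm z\<bar> = real n + (R + 1) / norm z"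
      using R(1) by (intro abs_of_nonneg) auto
    finally show ?thesis using z(2) by (simp add: distrib_right[of "real n"])
  qed
  have "norm (e (xs n)) > R" for n unfolding norm_xs by (simp add: add_nonneg_pos)
  then have V: "range xs \<subseteq> e -` V" using R(2) by auto
  have "filterlim (\<lambda>n. (R + 1) + real n * norm z) at_top sequentially"
    using z(2) by (intro filterlim_tendsto_add_at_top[OF tendsto_const]
        filterlim_at_top_mult_tendsto_pos[OF tendsto_const] filterlim_real_sequentially) auto
  then have top: "filterlim (\<lambda>n. norm (e (xs n))) at_top sequentially"
    by (simp add: norm_xs add_ac)
  obtain c n0 where c: "c > 0" "\<And>n u. n \<ge> n0 \<Longrightarrow> inner (P (xs n) u) u \<ge> c * (norm u)\<^sup>2"
    using P_coercive[OF V top] by blast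
  have "inner (Pinf u) u \<ge> c * (norm u)\<^sup>2" for u
  proof (rule tendsto_lowerbound)
    have "(\<lambda>n. P (xs n) u) \<longlonglongrightarrow> Pinf u"
      by (rule LIM_zero_cancel[OF tendsto_norm_zero_cancel[OF P_tendsto[OF V top]]])
    then show "(\<lambda>n. inner (P (xs n) u) u) \<longlonglongrightarrow> inner (Pinf u) u" by (rule tendsto_inner[OF _ tendsto_const])
    show "\<forall>\<^sub>F n in sequentially. inner (P (xs n) u) u \<ge> c * (norm u)\<^sup>2"
      using eventually_ge_at_top[of n0] by eventually_elim (rule c)
  qed simp
  then show ?thesis using c(1) by blast
qed

text \<open>
  \<open>B(\<infinity>)\<close> is coercive plus compact, hence bounded below on \<open>H\<^sup>\<plusminus>\<close>, where it is injective; being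
  self-adjoint it maps \<open>H\<^sup>\<plusminus>\<close> onto itself.
\<close>
lemma Binf_surj_orth:
  assumes "y \<in> orthogonal_comp (H0 Binf)"
  shows "\<exists>x\<in>orthogonal_comp (H0 Binf). Binf x = y"
proof -
  obtain c where c: "c > 0" "\<And>u. inner (Pinf u) u \<ge> c * (norm u)\<^sup>2" using Pinf_coercive by blast
  from coercive_plus_compact_bounded_below[OF Binf_decomposition c compact_Qinf subspace_orthogonal_comp
      closed_orthogonal_comp H0_orth_trivial]
  obtain d where d: "d > 0" "\<And>u. u \<in> orthogonal_comp (H0 Binf) \<Longrightarrow> d * norm u \<le> norm (Binf u)"
    by blast
  show ?thesis
    by (rule self_adjoint_bounded_below_surj[OF self_adjoint_Binf subspace_orthogonal_comp
          closed_orthogonal_comp _ d assms]) (use Binf_orth in auto)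
qed

lemma bij_betw_B_X: "bij_betw (B_X e Binf) (Xpm e Binf) (Xpm e Binf)"
  unfolding bij_betw_def
proof
  show "inj_on (B_X e Binf) (Xpm e Binf)"
  proof (rule inj_onI)
    fix x y assume xy: "x \<in> Xpm e Binf" "y \<in> Xpm e Binf" "B_X e Binf x = B_X e Binf y"
    then have "Binf (e (x - y)) = 0"
      by (metis e_B_X e.diff blinfun.diff_right right_minus_eq)
    moreover have "x - y \<in> Xpm e Binf" using xy subspace_diff[OF subspace_Xpm] by blast
    ultimately have "e (x - y) = e 0" using H0_orth_trivial by (simp add: Xpm_def e.zero)
    then have "x - y = 0" by (simp only: e_eq_iff)
    then show "x = y" by simp
  qed
  show "B_X e Binf ` Xpm e Binf = Xpm e Binf"
  proof
    show "Xpm e Binf \<subseteq> B_X e Binf ` Xpm e Binf"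
    proof
      fix y assume "y \<in> Xpm e Binf"
      then obtain u where u: "u \<in> orthogonal_comp (H0 Binf)" "Binf u = e y"
        using Binf_surj_orth[of "e y"] by (auto simp: Xpm_def)
      then obtain x where x: "u = e x" using range_e_if_Binf[of u] by auto
      then have "B_X e Binf x = y" using u(2) e_B_X by (metis e_eq_iff)
      then show "y \<in> B_X e Binf ` Xpm e Binf" using u(1) x by (auto simp: Xpm_def)
    qed
  qed (use B_X_Xpm in auto)
qed

definition B_X_inv :: "'x \<Rightarrow> 'x" where "B_X_inv = the_inv_into (Xpm e Binf) (B_X e Binf)"

lemma B_X_inv_Xpm: "y \<in> Xpm e Binf \<Longrightarrow> B_X_inv y \<in> Xpm e Binf"
  and B_X_B_X_inv: "y \<in> Xpm e Binf \<Longrightarrow> B_X e Binf (B_X_inv y) = y"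
  and B_X_inv_B_X: "x \<in> Xpm e Binf \<Longrightarrow> B_X_inv (B_X e Binf x) = x"
  using bij_betw_B_X
  by (auto simp: B_X_inv_def the_inv_into_f_f f_the_inv_into_f_bij_betw bij_betw_def the_inv_into_into)

lemma B_X_inv_unique: "x \<in> Xpm e Binf \<Longrightarrow> e y = Binf (e x) \<Longrightarrow> B_X_inv y = x"
  by (metis B_X_inv_B_X e_B_X e_eq_iff)

text \<open>
  The inverse of \<open>B(\<infinity>)\<close> on \<open>X\<^sup>\<plusminus>\<close>, extended by \<open>0\<close> on the kernel, has a closed graph, because \<open>B(\<infinity>)\<close> is
  continuous for the weaker norm of \<open>H\<close>.  Its boundedness is what makes the supremum \<open>C1_infty\<close> an
  operator norm.
\<close>
lemma bounded_linear_B_X_inv_ImP0: "bounded_linear (\<lambda>x. B_X_inv (ImP0 e Binf x))"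
proof (rule closed_graph_bounded_linear)
  have eG: "Binf (e (B_X_inv (ImP0 e Binf x))) = e (ImP0 e Binf x)" for x
    using B_X_B_X_inv[OF ImP0_Xpm] e_B_X by metis
  show "linear (\<lambda>x. B_X_inv (ImP0 e Binf x))"
  proof (rule linearI)
    fix x y and c :: real
    show "B_X_inv (ImP0 e Binf (x + y)) = B_X_inv (ImP0 e Binf x) + B_X_inv (ImP0 e Binf y)"
      by (rule B_X_inv_unique)
        (auto intro: subspace_add[OF subspace_Xpm] simp: B_X_inv_Xpm ImP0_Xpm ImP0.add e.add blinfun.add_right eG)
    show "B_X_inv (ImP0 e Binf (c *\<^sub>R x)) = c *\<^sub>R B_X_inv (ImP0 e Binf x)"
      by (rule B_X_inv_unique)
        (auto intro: subspace_scale[OF subspace_Xpm] simp: B_X_inv_Xpm ImP0_Xpm ImP0.scaleR e.scaleR blinfun.scaleR_right eG)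
  qed
  fix x :: "nat \<Rightarrow> 'x" and l w
  assume x: "x \<longlonglongrightarrow> l" and w: "(\<lambda>n. B_X_inv (ImP0 e Binf (x n))) \<longlonglongrightarrow> w"
  show "B_X_inv (ImP0 e Binf l) = w"
  proof (rule B_X_inv_unique)
    show "w \<in> Xpm e Binf"
      using closed_sequentially[OF closed_Xpm _ w] B_X_inv_Xpm ImP0_Xpm by blast
    have "(\<lambda>n. e (ImP0 e Binf (x n))) \<longlonglongrightarrow> e (ImP0 e Binf l)"
      by (intro e.tendsto ImP0.tendsto x)
    moreover have "(\<lambda>n. Binf (e (B_X_inv (ImP0 e Binf (x n))))) \<longlonglongrightarrow> Binf (e w)"
      by (intro blinfun.tendsto tendsto_const e.tendsto w)
    ultimately show "e (ImP0 e Binf l) = Binf (e w)"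
      unfolding eG using LIMSEQ_unique by blast
  qed
qed

lemma norm_B_X_inv_le: "y \<in> Xpm e Binf \<Longrightarrow> norm (B_X_inv y) \<le> C1_infty e Binf * norm y"
  and C1_infty_nonneg: "0 \<le> C1_infty e Binf"
proof -
  obtain K where K: "\<And>x. norm (B_X_inv (ImP0 e Binf x)) \<le> norm x * K"
    using bounded_linear.nonneg_bounded[OF bounded_linear_B_X_inv_ImP0] by blast
  then have GK: "norm (B_X_inv y) \<le> norm y * K" if "y \<in> Xpm e Binf" for y
    using ImP0_id[OF that] by metis
  have "norm (B_X_inv y) / norm y \<le> \<bar>K\<bar>" if "y \<in> Xpm e Binf" for y
  proof (cases "y = 0")
    case False
    then have "norm (B_X_inv y) / norm y \<le> K"
      using GK[OF that] by (simp add: divide_le_eq mult.commute)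
    then show ?thesis by linarith
  qed simp
  then have "bdd_above ((\<lambda>y. norm (B_X_inv y) / norm y) ` Xpm e Binf)"
    by (intro bdd_aboveI2)
  from cSUP_upper[OF _ this]
  have le: "norm (B_X_inv y) / norm y \<le> C1_infty e Binf" if "y \<in> Xpm e Binf" for y
    using that by (simp add: C1_infty_def onorm_on_def B_X_inv_def)
  show "norm (B_X_inv y) \<le> C1_infty e Binf * norm y" if "y \<in> Xpm e Binf"
  proof (cases "y = 0")
    case True
    then show ?thesis using GK[OF that] by simp
  next
    case False
    then show ?thesis using le[OF that] by (simp add: divide_le_eq)
  qed
  show "0 \<le> C1_infty e Binf"
    using le[OF subspace_0[OF subspace_Xpm]] by simp
qed

end

section \<open>The reduction map\<close>

lemma weak_contraction_if_strong:
  assumes "strong_contraction e V A Binf R1 \<kappa> \<rho>"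
  shows "weak_contraction e V A Binf R1 \<kappa> \<rho>"
  using assms unfolding strong_contraction_def weak_contraction_def
  by (metis (no_types, opaque_lifting) add_diff_cancel_left diff_diff_eq)

locale contraction_at_infinity = splitting_at_infinity +
  fixes R1 \<kappa> :: real and \<rho> :: ereal
  assumes contraction: "weak_contraction e V A Binf R1 \<kappa> \<rho>"
begin

lemma \<kappa>_gt_1: "\<kappa> > 1"
  and in_V: "z \<in> H0 Binf \<Longrightarrow> norm z \<ge> R1 \<Longrightarrow> x \<in> Xpm e Binf \<Longrightarrow> ereal (norm x) \<le> \<rho> \<Longrightarrow> z + e x \<in> V"
  and \<rho>_cases: "M_A e Binf A < \<infinity> \<and> ereal (\<kappa> / (\<kappa> - 1) * C1_infty e Binf) * M_A e Binf A < \<rho> \<and> \<rho> < \<infinity> \<or> \<rho> = \<infinity>"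
  and N_map_contraction: "z \<in> H0 Binf \<Longrightarrow> norm z \<ge> R1 \<Longrightarrow> x\<^sub>1 \<in> Xpm e Binf \<Longrightarrow> x\<^sub>2 \<in> Xpm e Binf \<Longrightarrow>
    ereal (norm x\<^sub>1) < \<rho> \<Longrightarrow> ereal (norm x\<^sub>2) < \<rho> \<Longrightarrow>
    norm (N_map e Binf A z x\<^sub>1 - N_map e Binf A z x\<^sub>2) \<le> 1 / (\<kappa> * C1_infty e Binf) * norm (x\<^sub>1 - x\<^sub>2)"
  using contraction unfolding weak_contraction_def admissible_constants_def by blast+

lemma P0_X_in_eV:
  "z \<in> H0 Binf \<Longrightarrow> norm z \<ge> R1 \<Longrightarrow> x \<in> Xpm e Binf \<Longrightarrow> ereal (norm x) \<le> \<rho> \<Longrightarrow> P0_X z + x \<in> e -` V"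
  using in_V by (simp add: e.add e_P0_X_id)

lemma N_map_eq: "z \<in> H0 Binf \<Longrightarrow> N_map e Binf A z x = ImP0 e Binf (A (P0_X z + x)) - B_X e Binf x"
  by (simp add: N_map_def inv_e_H0)

lemma N_map_Xpm: "z \<in> H0 Binf \<Longrightarrow> N_map e Binf A z x \<in> Xpm e Binf"
  by (simp add: N_map_eq subspace_diff[OF subspace_Xpm] ImP0_Xpm B_X_Xpm)

definition residual_sup :: "real \<Rightarrow> ereal" where
  "residual_sup R = (SUP z\<in>{z \<in> H0 Binf. norm (inv e z) \<ge> R}. ereal (norm (ImP0 e Binf (A (inv e z)))))"

lemma M_A_eq: "M_A e Binf A = (INF R. residual_sup R)"
  and residual_sup_tendsto: "(residual_sup \<longlongrightarrow> M_A e Binf A) at_top"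
proof -
  have anti: "residual_sup R' \<le> residual_sup R" if "R \<le> R'" for R R'
    unfolding residual_sup_def using that by (intro SUP_subset_mono) auto
  have lim: "(residual_sup \<longlongrightarrow> (INF R. residual_sup R)) at_top"
  proof (rule order_tendstoI)
    fix a assume a: "a < (INF R. residual_sup R)"
    then show "\<forall>\<^sub>F R in at_top. a < residual_sup R"
      by (intro always_eventually allI) (metis INF_lower UNIV_I less_le_trans)
  next
    fix a assume "(INF R. residual_sup R) < a"
    then obtain R where R: "residual_sup R < a" by (auto simp: INF_less_iff)
    show "\<forall>\<^sub>F R in at_top. residual_sup R < a"
      using eventually_ge_at_top[of R] by eventually_elim (metis R anti le_less_trans)
  qed
  then show "M_A e Binf A = (INF R. residual_sup R)"
    unfolding M_A_def residual_sup_def[symmetric] by (intro tendsto_Lim) auto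
  with lim show "(residual_sup \<longlongrightarrow> M_A e Binf A) at_top" by simp
qed

lemma M_A_nonneg: "0 \<le> M_A e Binf A"
  unfolding M_A_eq
proof (rule INF_greatest)
  fix R :: real
  have "\<exists>z\<in>H0 Binf. z \<noteq> 0" by (rule H0_nontrivial)
  then obtain z where z: "z \<in> H0 Binf" "z \<noteq> 0" by blast
  define w where "w = (\<bar>R\<bar> / norm z) *\<^sub>R z"
  have w: "w \<in> H0 Binf" unfolding w_def by (intro subspace_scale[OF subspace_H0] z)
  have "R \<le> norm w" using z by (simp add: w_def)
  also have "\<dots> \<le> norm (inv e w)" using norm_e_le[of "inv e w"] e_inv_e[OF H0_range_e[OF w]] by simp
  finally have "R \<le> norm (inv e w)" .
  then show "0 \<le> residual_sup R"
    unfolding residual_sup_def using w by (intro SUP_upper2[of w]) auto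
qed

lemma \<rho>_pos: "\<rho> > 0"
  using \<rho>_cases
proof
  assume *: "M_A e Binf A < \<infinity> \<and> ereal (\<kappa> / (\<kappa> - 1) * C1_infty e Binf) * M_A e Binf A < \<rho> \<and> \<rho> < \<infinity>"
  have "0 \<le> ereal (\<kappa> / (\<kappa> - 1) * C1_infty e Binf) * M_A e Binf A"
    using \<kappa>_gt_1 C1_infty_nonneg M_A_nonneg by (intro ereal_0_le_mult) auto
  then show ?thesis using * by (metis le_less_trans)
qed simp

text \<open>
  Uniqueness concerns solutions in the closed \<open>\<rho>\<close>-ball, whereas the contraction inequality is given on
  the open ball.  It is extended radially, \<open>s \<rightarrow> 1\<close> from below: along a ray \<open>B(\<infinity>)\<close> is continuous by
  mere linearity.
\<close>
lemma N_map_contraction_closed: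
  assumes z: "z \<in> H0 Binf" "norm z \<ge> R1" and x: "x\<^sub>1 \<in> Xpm e Binf" "x\<^sub>2 \<in> Xpm e Binf"
    and \<rho>: "ereal (norm x\<^sub>1) \<le> \<rho>" "ereal (norm x\<^sub>2) \<le> \<rho>"
  shows "C1_infty e Binf * norm (N_map e Binf A z x\<^sub>1 - N_map e Binf A z x\<^sub>2) \<le> norm (x\<^sub>1 - x\<^sub>2) / \<kappa>"
proof (rule tendsto_le)
  define N where "N = N_map e Binf A z"
  have shrink: "ereal (norm (s *\<^sub>R x)) < \<rho>" if "0 < s" "s < 1" "ereal (norm x) \<le> \<rho>" for s x
  proof (cases "x = 0")
    case True
    then show ?thesis using \<rho>_pos by (simp add: zero_ereal_def)
  next
    case False
    then have "ereal (norm (s *\<^sub>R x)) < ereal (norm x)" using that by simp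
    then show ?thesis using that(3) by (rule less_le_trans)
  qed
  have lim: "((\<lambda>s. N (s *\<^sub>R x)) \<longlongrightarrow> N x) (at_left 1)"
    if "x \<in> Xpm e Binf" "ereal (norm x) \<le> \<rho>" for x
  proof -
    have sx: "((\<lambda>s. P0_X z + s *\<^sub>R x) \<longlongrightarrow> P0_X z + 1 *\<^sub>R x) (at_left 1)" by (intro tendsto_intros)
    have "isCont A (P0_X z + 1 *\<^sub>R x)"
      using continuous_on_interior[OF continuous_A] P0_X_in_eV[OF z that] interior_open[OF open_eV] by simp
    from isCont_tendsto_compose[OF this sx]
    have "((\<lambda>s. ImP0 e Binf (A (P0_X z + s *\<^sub>R x)) - s *\<^sub>R B_X e Binf x) \<longlongrightarrow>
        ImP0 e Binf (A (P0_X z + 1 *\<^sub>R x)) - 1 *\<^sub>R B_X e Binf x) (at_left 1)"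
      by (intro tendsto_intros ImP0.tendsto)
    then show ?thesis by (simp add: N_def N_map_eq[OF z(1)] B_X.scale)
  qed
  show "((\<lambda>s. C1_infty e Binf * norm (N (s *\<^sub>R x\<^sub>1) - N (s *\<^sub>R x\<^sub>2))) \<longlongrightarrow>
      C1_infty e Binf * norm (N_map e Binf A z x\<^sub>1 - N_map e Binf A z x\<^sub>2)) (at_left 1)"
    unfolding N_def[symmetric] by (intro tendsto_intros lim x \<rho>)
  have "((\<lambda>s. norm (s *\<^sub>R x\<^sub>1 - s *\<^sub>R x\<^sub>2) / \<kappa>) \<longlongrightarrow> norm (1 *\<^sub>R x\<^sub>1 - 1 *\<^sub>R x\<^sub>2) / \<kappa>) (at_left 1)"
    using \<kappa>_gt_1 by (intro tendsto_intros) auto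
  then show "((\<lambda>s. norm (s *\<^sub>R x\<^sub>1 - s *\<^sub>R x\<^sub>2) / \<kappa>) \<longlongrightarrow> norm (x\<^sub>1 - x\<^sub>2) / \<kappa>) (at_left 1)" by simp
  have "\<forall>\<^sub>F s in at_left 1. s \<in> {0<..<1::real}" by (rule eventually_at_leftI[of 0]) auto
  then show "\<forall>\<^sub>F s in at_left 1. C1_infty e Binf * norm (N (s *\<^sub>R x\<^sub>1) - N (s *\<^sub>R x\<^sub>2))
      \<le> norm (s *\<^sub>R x\<^sub>1 - s *\<^sub>R x\<^sub>2) / \<kappa>"
  proof eventually_elim
    case (elim s)
    let ?d = "norm (s *\<^sub>R x\<^sub>1 - s *\<^sub>R x\<^sub>2)"
    have "norm (N (s *\<^sub>R x\<^sub>1) - N (s *\<^sub>R x\<^sub>2)) \<le> 1 / (\<kappa> * C1_infty e Binf) * ?d"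
      unfolding N_def using elim
      by (intro N_map_contraction z subspace_scale[OF subspace_Xpm] x shrink \<rho>) auto
    from mult_left_mono[OF this C1_infty_nonneg]
    have "C1_infty e Binf * norm (N (s *\<^sub>R x\<^sub>1) - N (s *\<^sub>R x\<^sub>2))
        \<le> C1_infty e Binf * (1 / (\<kappa> * C1_infty e Binf) * ?d)" .
    also have "\<dots> \<le> ?d / \<kappa>" using \<kappa>_gt_1 by (cases "C1_infty e Binf = 0") auto
    finally show ?case .
  qed
qed (simp add: trivial_limit_at_left_real)

text \<open>
  Both solutions satisfy \<open>B(\<infinity>) x = - N(z, x)\<close>.  In the difference, the change of \<open>N\<close> due to \<open>x\<close> is absorbed
  on the left by the contraction, and only its change due to \<open>z\<close>, with \<open>x\<close> held fixed, remains.  The case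
  \<open>z' = z\<close> gives uniqueness, continuity of \<open>A\<close> gives continuity of the solution, and differentiability
  of \<open>A\<close> gives a Lipschitz bound.
\<close>
lemma reduced_solution_stability:
  assumes z: "z \<in> H0 Binf" "norm z \<ge> R1" and z': "z' \<in> H0 Binf" "norm z' \<ge> R1"
    and x: "x \<in> Xpm e Binf" "ereal (norm x) \<le> \<rho>" "ImP0 e Binf (A (P0_X z + x)) = 0"
    and x': "x' \<in> Xpm e Binf" "ereal (norm x') \<le> \<rho>" "ImP0 e Binf (A (P0_X z' + x')) = 0"
  shows "(1 - 1 / \<kappa>) * norm (x' - x)
    \<le> C1_infty e Binf * norm (ImP0 e Binf (A (P0_X z' + x) - A (P0_X z + x)))"
proof -
  let ?N = "N_map e Binf A" and ?C = "C1_infty e Binf"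
  have mem: "x' - x \<in> Xpm e Binf" using x x' subspace_diff[OF subspace_Xpm] by blast
  have split: "B_X e Binf (x' - x) = - ((?N z' x' - ?N z' x) + ImP0 e Binf (A (P0_X z' + x) - A (P0_X z + x)))"
    using x(3) x'(3) by (simp add: N_map_eq z z' B_X.diff ImP0.diff)
  have "norm (x' - x) = norm (B_X_inv (B_X e Binf (x' - x)))" using mem by (simp add: B_X_inv_B_X)
  also have "\<dots> \<le> ?C * norm (B_X e Binf (x' - x))" by (intro norm_B_X_inv_le B_X_Xpm)
  also have "\<dots> \<le> ?C * (norm (?N z' x' - ?N z' x) + norm (ImP0 e Binf (A (P0_X z' + x) - A (P0_X z + x))))"
    unfolding split norm_minus_cancel by (intro mult_left_mono norm_triangle_ineq C1_infty_nonneg)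
  also have "\<dots> \<le> norm (x' - x) / \<kappa> + ?C * norm (ImP0 e Binf (A (P0_X z' + x) - A (P0_X z + x)))"
    using N_map_contraction_closed[OF z' x'(1) x(1) x'(2) x(2)] by (simp add: distrib_left)
  finally show ?thesis by (simp add: left_diff_distrib)
qed

text \<open>
  The projected equation is the fixed point equation of \<open>x \<mapsto> - B(\<infinity>)\<^sup>-\<^sup>1 N(z, x)\<close>, a contraction
  with factor \<open>1 / \<kappa>\<close>.
\<close>
lemma fixed_point_solution:
  assumes z: "z \<in> H0 Binf" "norm z \<ge> R1" and K: "closed K" "K \<subseteq> Xpm e Binf" "0 \<in> K"
    and K\<rho>: "\<And>x. x \<in> K \<Longrightarrow> ereal (norm x) \<le> \<rho>"
    and self: "\<And>x. x \<in> K \<Longrightarrow> - B_X_inv (N_map e Binf A z x) \<in> K"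
  shows "\<exists>x\<in>K. ImP0 e Binf (A (P0_X z + x)) = 0"
proof -
  have B_X_inv_diff: "B_X_inv a - B_X_inv b = B_X_inv (a - b)" if "a \<in> Xpm e Binf" "b \<in> Xpm e Binf" for a b
    using that bounded_linear.linear[OF bounded_linear_B_X_inv_ImP0, THEN linear_diff, of a b]
    by (simp add: ImP0_id subspace_diff[OF subspace_Xpm])
  have "\<exists>!x\<in>K. - B_X_inv (N_map e Binf A z x) = x"
  proof (rule Banach_fix[where c = "1 / \<kappa>"])
    show "complete K" "K \<noteq> {}" using K by (auto simp: complete_eq_closed)
    show "0 \<le> 1 / \<kappa>" "1 / \<kappa> < 1" using \<kappa>_gt_1 by auto
    show "(\<lambda>x. - B_X_inv (N_map e Binf A z x)) ` K \<subseteq> K" using self by blast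
    fix x y assume xy: "x \<in> K" "y \<in> K"
    have "dist (- B_X_inv (N_map e Binf A z x)) (- B_X_inv (N_map e Binf A z y))
        = norm (B_X_inv (N_map e Binf A z x - N_map e Binf A z y))"
      by (simp only: dist_minus) (simp add: dist_norm B_X_inv_diff N_map_Xpm z)
    also have "\<dots> \<le> C1_infty e Binf * norm (N_map e Binf A z x - N_map e Binf A z y)"
      using z by (intro norm_B_X_inv_le subspace_diff[OF subspace_Xpm] N_map_Xpm)
    also have "\<dots> \<le> norm (x - y) / \<kappa>"
      using xy K(2) by (intro N_map_contraction_closed z K\<rho>) auto
    finally show "dist (- B_X_inv (N_map e Binf A z x)) (- B_X_inv (N_map e Binf A z y)) \<le> 1 / \<kappa> * dist x y"
      by (simp add: dist_norm)
  qed
  then obtain x where x: "x \<in> K" "- B_X_inv (N_map e Binf A z x) = x" by blast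
  have "B_X e Binf x = - N_map e Binf A z x"
    using B_X_B_X_inv[OF N_map_Xpm[OF z(1)]] x(2) by (metis B_X.neg)
  then have "ImP0 e Binf (A (P0_X z + x)) = 0" by (simp add: N_map_eq z)
  then show ?thesis using x by blast
qed

text \<open>
  For \<open>\<rho> = \<infinity>\<close> the contraction acts on all of \<open>X\<^sup>\<plusminus>\<close>.  Otherwise let \<open>m\<close> be slightly larger than \<open>M(A)\<close>,
  so that \<open>\<parallel>N(z, 0)\<parallel> \<le> m\<close> for large \<open>z\<close>.  The ball of radius \<open>r = \<kappa> / (\<kappa> - 1) C\<^sub>1 m\<close> is then invariant,
  as \<open>r / \<kappa> + C\<^sub>1 m = r\<close>, and the lower bound on \<open>\<rho>\<close> leaves room for \<open>r \<le> \<rho>\<close>.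
\<close>
lemma reduced_solution_exists:
  "\<exists>R0\<ge>R1. \<forall>z\<in>H0 Binf. norm z > R0 \<longrightarrow>
     (\<exists>x\<in>Xpm e Binf. ereal (norm x) \<le> \<rho> \<and> ImP0 e Binf (A (P0_X z + x)) = 0)"
  using \<rho>_cases
proof
  assume "\<rho> = \<infinity>"
  then show ?thesis
    using fixed_point_solution[OF _ _ closed_Xpm subset_refl subspace_0[OF subspace_Xpm]]
      subspace_neg[OF subspace_Xpm B_X_inv_Xpm[OF N_map_Xpm]]
    by (intro exI[of _ R1]) auto
next
  assume *: "M_A e Binf A < \<infinity> \<and> ereal (\<kappa> / (\<kappa> - 1) * C1_infty e Binf) * M_A e Binf A < \<rho> \<and> \<rho> < \<infinity>"
  obtain M where M: "M_A e Binf A = ereal M" "M \<ge> 0"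
    using * M_A_nonneg by (cases "M_A e Binf A") auto
  obtain r0 where r0: "\<rho> = ereal r0" using * \<rho>_pos by (cases \<rho>) auto
  define a where "a = \<kappa> / (\<kappa> - 1) * C1_infty e Binf"
  have a: "a \<ge> 0" using \<kappa>_gt_1 C1_infty_nonneg by (simp add: a_def)
  have aM: "a * M < r0" using * by (simp add: M r0 a_def)
  \<comment> \<open>The denominator is \<open>a + 1\<close> because \<open>a\<close> vanishes when \<open>X\<^sup>\<plusminus>\<close> is trivial.\<close>
  define m where "m = M + (r0 - a * M) / (a + 1)"
  have "m > M" using a aM by (simp add: m_def)
  have am: "a * m \<le> r0"
  proof -
    have "a * m = a * M + a / (a + 1) * (r0 - a * M)" by (simp add: m_def distrib_left)
    also have "\<dots> \<le> a * M + 1 * (r0 - a * M)"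
      using a aM by (intro add_left_mono mult_right_mono) auto
    finally show ?thesis by simp
  qed
  have "\<forall>\<^sub>F R in at_top. residual_sup R < ereal m"
    using \<open>m > M\<close> by (intro order_tendstoD(2)[OF residual_sup_tendsto]) (simp add: M)
  then obtain R' where R': "residual_sup R' < ereal m"
    using eventually_happens[of _ "at_top :: real filter"] by auto
  have res: "norm (ImP0 e Binf (A (P0_X z))) \<le> m" if "z \<in> H0 Binf" "norm z \<ge> R'" for z
  proof -
    have "R' \<le> norm (P0_X z)" using norm_e_le[of "P0_X z"] that by (simp add: e_P0_X_id)
    then have "ereal (norm (ImP0 e Binf (A (P0_X z)))) \<le> residual_sup R'"
      unfolding residual_sup_def using that by (intro SUP_upper2[of z]) (auto simp: inv_e_H0)
    then have "ereal (norm (ImP0 e Binf (A (P0_X z)))) < ereal m" using R' by (rule le_less_trans)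
    then show ?thesis by simp
  qed
  define K where "K = Xpm e Binf \<inter> cball 0 (a * m)"
  have m0: "m \<ge> 0" using M \<open>m > M\<close> by simp
  have K\<rho>: "ereal (norm x) \<le> \<rho>" if "x \<in> K" for x using that am by (simp add: K_def r0)
  have K0: "0 \<in> K" using a m0 subspace_0[OF subspace_Xpm] by (simp add: K_def)
  have "\<exists>x\<in>K. ImP0 e Binf (A (P0_X z + x)) = 0" if z: "z \<in> H0 Binf" "norm z > max R1 R'" for z
  proof (rule fixed_point_solution)
    show "closed K" "K \<subseteq> Xpm e Binf" by (auto simp: K_def closed_Int closed_Xpm)
    fix x assume x: "x \<in> K"
    let ?N = "N_map e Binf A z"
    have N0: "norm (?N 0) \<le> m" using res[of z] z by (simp add: N_map_eq B_X.zero)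
    have "norm (- B_X_inv (?N x)) \<le> C1_infty e Binf * norm (?N x)"
      using z by (simp add: norm_B_X_inv_le N_map_Xpm)
    also have "\<dots> \<le> C1_infty e Binf * (norm (?N x - ?N 0) + norm (?N 0))"
      using C1_infty_nonneg norm_triangle_ineq[of "?N x - ?N 0" "?N 0"] by (intro mult_left_mono) auto
    also have "\<dots> \<le> norm (x - 0) / \<kappa> + C1_infty e Binf * m"
      unfolding distrib_left using z x K0 N0 C1_infty_nonneg
      by (intro add_mono N_map_contraction_closed K\<rho> mult_left_mono) (auto simp: K_def)
    also have "\<dots> \<le> a * m / \<kappa> + C1_infty e Binf * m"
      using x \<kappa>_gt_1 by (simp add: K_def divide_right_mono)
    also have "\<dots> = a * m" using \<kappa>_gt_1 by (simp add: a_def field_simps)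
    finally show "- B_X_inv (?N x) \<in> K"
      using z by (simp add: K_def subspace_neg[OF subspace_Xpm] B_X_inv_Xpm N_map_Xpm)
  qed (use z K0 K\<rho> in auto)
  then have "\<exists>x\<in>Xpm e Binf. ereal (norm x) \<le> \<rho> \<and> ImP0 e Binf (A (P0_X z + x)) = 0"
    if "z \<in> H0 Binf" "norm z > max R1 R'" for z
    using that K\<rho> unfolding K_def by blast
  then show ?thesis by (intro exI[of _ "max R1 R'"]) auto
qed

lemma reduction_mapD:
  assumes "reduction_map e A Binf \<rho> R h" "z \<in> ball_infty Binf R" "R \<ge> R1"
  shows "z \<in> H0 Binf" "norm z \<ge> R1" "h z \<in> Xpm e Binf" "ereal (norm (h z)) \<le> \<rho>"
    "ImP0 e Binf (A (P0_X z + h z)) = 0"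
  using assms by (auto simp: reduction_map_def ball_infty_def simp flip: inv_e_H0)

lemma reduction_map_exists: "\<exists>R0\<ge>R1. \<forall>R\<ge>R0. \<exists>h. reduction_map e A Binf \<rho> R h"
proof -
  obtain R0 where R0: "R0 \<ge> R1"
    "\<And>z. z \<in> H0 Binf \<Longrightarrow> norm z > R0 \<Longrightarrow> \<exists>x\<in>Xpm e Binf. ereal (norm x) \<le> \<rho> \<and> ImP0 e Binf (A (P0_X z + x)) = 0"
    using reduced_solution_exists by blast
  then obtain h where h: "\<And>z. z \<in> H0 Binf \<Longrightarrow> norm z > R0 \<Longrightarrow>
      h z \<in> Xpm e Binf \<and> ereal (norm (h z)) \<le> \<rho> \<and> ImP0 e Binf (A (P0_X z + h z)) = 0"
    by metis
  have "reduction_map e A Binf \<rho> R h" if R: "R \<ge> R0" for R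
  proof -
    have mem: "z \<in> H0 Binf" "norm z \<ge> R1" "norm z > R0" if "z \<in> ball_infty Binf R" for z
      using that R R0(1) by (auto simp: ball_infty_def)
    have "(h \<longlongrightarrow> h z) (at z within ball_infty Binf R)" if z: "z \<in> ball_infty Binf R" for z
    proof -
      define K where "K = C1_infty e Binf / (1 - 1 / \<kappa>)"
      have "isCont A (P0_X z + h z)"
        using continuous_on_interior[OF continuous_A] P0_X_in_eV[of z "h z"] mem[OF z] h[of z]
          interior_open[OF open_eV] by simp
      moreover have "((\<lambda>z'. P0_X z' + h z) \<longlongrightarrow> P0_X z + h z) (at z within ball_infty Binf R)"
        by (intro tendsto_intros P0_X.tendsto)
      ultimately have "((\<lambda>z'. A (P0_X z' + h z)) \<longlongrightarrow> A (P0_X z + h z)) (at z within ball_infty Binf R)"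
        by (rule isCont_tendsto_compose)
      then have "((\<lambda>z'. K * norm (ImP0 e Binf (A (P0_X z' + h z) - A (P0_X z + h z)))) \<longlongrightarrow>
          K * norm (ImP0 e Binf (A (P0_X z + h z) - A (P0_X z + h z)))) (at z within ball_infty Binf R)"
        by (intro tendsto_intros ImP0.tendsto)
      then have lim: "((\<lambda>z'. K * norm (ImP0 e Binf (A (P0_X z' + h z) - A (P0_X z + h z)))) \<longlongrightarrow> 0)
          (at z within ball_infty Binf R)" by (simp add: ImP0.zero)
      have "\<forall>\<^sub>F z' in at z within ball_infty Binf R.
          norm (h z' - h z) \<le> K * norm (ImP0 e Binf (A (P0_X z' + h z) - A (P0_X z + h z)))"
        unfolding eventually_at_filter
      proof (intro always_eventually allI impI)
        fix z' assume z': "z' \<in> ball_infty Binf R"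
        have "(1 - 1 / \<kappa>) * norm (h z' - h z)
            \<le> C1_infty e Binf * norm (ImP0 e Binf (A (P0_X z' + h z) - A (P0_X z + h z)))"
          using mem[OF z] mem[OF z'] h[of z] h[of z'] by (intro reduced_solution_stability) auto
        moreover have "1 - 1 / \<kappa> > 0" using \<kappa>_gt_1 by simp
        ultimately show "norm (h z' - h z) \<le> K * norm (ImP0 e Binf (A (P0_X z' + h z) - A (P0_X z + h z)))"
          by (simp add: K_def pos_le_divide_eq mult.commute)
      qed
      then have "((\<lambda>z'. h z' - h z) \<longlongrightarrow> 0) (at z within ball_infty Binf R)"
        using lim by (rule Lim_null_comparison)
      then show ?thesis by (rule LIM_zero_cancel)
    qed
    then have "continuous_on (ball_infty Binf R) h" by (simp add: continuous_on_def)
    then show ?thesis using h mem by (simp add: reduction_map_def inv_e_H0)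
  qed
  then show ?thesis using R0(1) by blast
qed

lemma reduction_map_unique:
  assumes R: "R \<ge> R1" and h: "reduction_map e A Binf \<rho> R h" and h': "reduction_map e A Binf \<rho> R h'"
    and z: "z \<in> ball_infty Binf R"
  shows "h' z = h z"
proof -
  have "(1 - 1 / \<kappa>) * norm (h' z - h z) \<le> 0"
    using reduced_solution_stability[of z z "h z" "h' z"]
      reduction_mapD[OF h z R] reduction_mapD[OF h' z R] by (simp add: ImP0.zero)
  then show ?thesis using \<kappa>_gt_1 by (simp add: mult_le_0_iff)
qed

section \<open>Critical points of the reduced functional\<close>

text \<open>
  In the stability estimate along \<open>z + t u\<close> the right-hand side is the increment of \<open>A\<close> along a line,
  which is \<open>O(t)\<close> since \<open>A\<close> has directional derivatives.
\<close>
lemma reduction_map_lipschitz_along_lines: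
  assumes R: "R \<ge> R1" and h: "reduction_map e A Binf \<rho> R h" and z: "z \<in> ball_infty Binf R"
    and u: "u \<in> H0 Binf"
  shows "\<exists>K. \<forall>\<^sub>F t in at 0. z + t *\<^sub>R u \<in> ball_infty Binf R \<and> norm (h (z + t *\<^sub>R u) - h z) \<le> K * \<bar>t\<bar>"
proof -
  note hz = reduction_mapD[OF h z R]
  let ?y = "P0_X z + h z"
  obtain d where d: "has_dir_deriv A ?y (P0_X u) d"
    using diff_A P0_X_in_eV[OF hz(1-4)] unfolding cont_dir_differentiable_on_def by blast
  have "((\<lambda>t. norm (ImP0 e Binf ((A (?y + t *\<^sub>R P0_X u) - A ?y) /\<^sub>R t))) \<longlongrightarrow> norm (ImP0 e Binf d)) (at 0)"
    using d unfolding has_dir_deriv_def by (intro tendsto_intros ImP0.tendsto)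
  then have "\<forall>\<^sub>F t in at 0. norm (ImP0 e Binf ((A (?y + t *\<^sub>R P0_X u) - A ?y) /\<^sub>R t)) < norm (ImP0 e Binf d) + 1"
    by (rule order_tendstoD) simp
  then have ev1: "\<forall>\<^sub>F t in at 0. norm (ImP0 e Binf (A (?y + t *\<^sub>R P0_X u) - A ?y)) \<le> (norm (ImP0 e Binf d) + 1) * \<bar>t\<bar>"
    unfolding eventually_at_filter
  proof eventually_elim
    case (elim t)
    show ?case
    proof (intro impI)
      assume "t \<noteq> 0"
      then have "norm (ImP0 e Binf (A (?y + t *\<^sub>R P0_X u) - A ?y)) / \<bar>t\<bar> < norm (ImP0 e Binf d) + 1"
        using elim by (simp add: ImP0.scaleR divide_inverse mult.commute)
      then show "norm (ImP0 e Binf (A (?y + t *\<^sub>R P0_X u) - A ?y)) \<le> (norm (ImP0 e Binf d) + 1) * \<bar>t\<bar>"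
        using \<open>t \<noteq> 0\<close> by (simp add: pos_divide_less_eq less_imp_le)
    qed
  qed
  have "((\<lambda>t. norm (z + t *\<^sub>R u)) \<longlongrightarrow> norm (z + 0 *\<^sub>R u)) (at 0)"
    by (intro tendsto_norm tendsto_add tendsto_scaleR tendsto_const tendsto_ident_at)
  then have "\<forall>\<^sub>F t in at 0. R < norm (z + t *\<^sub>R u)"
    using z by (intro order_tendstoD(1)) (auto simp: ball_infty_def)
  then have ev2: "\<forall>\<^sub>F t in at 0. z + t *\<^sub>R u \<in> ball_infty Binf R"
    by eventually_elim
      (use hz(1) u in \<open>auto simp: ball_infty_def intro: subspace_add[OF subspace_H0] subspace_scale[OF subspace_H0]\<close>)
  define K where "K = C1_infty e Binf * (norm (ImP0 e Binf d) + 1) / (1 - 1 / \<kappa>)"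
  have "\<forall>\<^sub>F t in at 0. z + t *\<^sub>R u \<in> ball_infty Binf R \<and> norm (h (z + t *\<^sub>R u) - h z) \<le> K * \<bar>t\<bar>"
    using ev1 ev2
  proof eventually_elim
    case (elim t)
    note hz' = reduction_mapD[OF h elim(2) R]
    have "(1 - 1 / \<kappa>) * norm (h (z + t *\<^sub>R u) - h z)
        \<le> C1_infty e Binf * norm (ImP0 e Binf (A (P0_X (z + t *\<^sub>R u) + h z) - A (P0_X z + h z)))"
      by (rule reduced_solution_stability[OF hz(1,2) hz'(1,2) hz(3-5) hz'(3-5)])
    also have "P0_X (z + t *\<^sub>R u) + h z = ?y + t *\<^sub>R P0_X u" by (simp add: P0_X.add P0_X.scaleR)
    also have "C1_infty e Binf * norm (ImP0 e Binf (A (?y + t *\<^sub>R P0_X u) - A ?y))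
        \<le> C1_infty e Binf * ((norm (ImP0 e Binf d) + 1) * \<bar>t\<bar>)"
      using elim(1) C1_infty_nonneg by (rule mult_left_mono)
    finally have "(1 - 1 / \<kappa>) * norm (h (z + t *\<^sub>R u) - h z)
        \<le> C1_infty e Binf * ((norm (ImP0 e Binf d) + 1) * \<bar>t\<bar>)" .
    moreover have "1 - 1 / \<kappa> > 0" using \<kappa>_gt_1 by simp
    ultimately have "norm (h (z + t *\<^sub>R u) - h z) \<le> K * \<bar>t\<bar>"
      by (simp add: K_def pos_le_divide_eq mult_ac)
    then show ?case using elim(2) by blast
  qed
  then show ?thesis by blast
qed

lemma L_mean_value:
  assumes y: "\<And>s. 0 \<le> s \<Longrightarrow> s \<le> 1 \<Longrightarrow> y + s *\<^sub>R w \<in> e -` V"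
  shows "\<exists>s. 0 < s \<and> s < 1 \<and> L (e (y + w)) - L (e y) = inner (e (A (y + s *\<^sub>R w))) (e w)"
proof -
  have "has_dir_deriv L (e y + s *\<^sub>R e w) (e w) (inner (e (A (y + s *\<^sub>R w))) (e w))"
    if "0 \<le> s" "s \<le> 1" for s
    using has_dir_deriv_dir_deriv[OF diff_L, of "e (y + s *\<^sub>R w)" "e w"] y[OF that]
      gradient[of "y + s *\<^sub>R w" w] by (simp add: e.add e.scaleR)
  from dir_deriv_mean_value[OF this] show ?thesis by (simp add: e.add)
qed

text \<open>
  Put \<open>y = z + h(z)\<close> and let \<open>\<Delta> t\<close> be the displacement of \<open>z + t u + h(z + t u)\<close> from \<open>y\<close>, an element of
  \<open>X\<close> of size \<open>O(t)\<close>.  By the mean value theorem the increment of the functional is \<open>(A(y), \<Delta> t)\<close> up to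
  \<open>o(t)\<close>, because \<open>A\<close> is continuous at \<open>y\<close>.  The part \<open>h(z + t u) - h(z)\<close> of \<open>\<Delta> t\<close> lies in \<open>X\<^sup>\<plusminus>\<close> and
  is orthogonal to \<open>A(y)\<close>, which lies in the kernel by the reduction equation; what remains is
  \<open>t (A(y), u)\<close>.
\<close>
lemma L_infty_has_dir_deriv:
  assumes R: "R \<ge> R1" and h: "reduction_map e A Binf \<rho> R h" and z: "z \<in> ball_infty Binf R"
    and u: "u \<in> H0 Binf"
  shows "has_dir_deriv (L_infty e L h) z u (inner (e (A (P0_X z + h z))) u)"
proof -
  note hz = reduction_mapD[OF h z R]
  let ?y = "P0_X z + h z"
  define \<Delta> where "\<Delta> t = t *\<^sub>R P0_X u + (h (z + t *\<^sub>R u) - h z)" for t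
  obtain K where K: "\<forall>\<^sub>F t in at 0. z + t *\<^sub>R u \<in> ball_infty Binf R \<and> norm (h (z + t *\<^sub>R u) - h z) \<le> K * \<bar>t\<bar>"
    using reduction_map_lipschitz_along_lines[OF assms] by blast
  define K' where "K' = norm (P0_X u) + K"
  have \<Delta>_le: "\<forall>\<^sub>F t in at 0. norm (\<Delta> t) \<le> K' * \<bar>t\<bar>"
    using K
  proof eventually_elim
    case (elim t)
    have "norm (\<Delta> t) \<le> \<bar>t\<bar> * norm (P0_X u) + norm (h (z + t *\<^sub>R u) - h z)"
      unfolding \<Delta>_def by (metis norm_scaleR norm_triangle_ineq)
    then show ?case using elim by (simp add: K'_def algebra_simps)
  qed
  have \<Delta>_lim: "(\<Delta> \<longlongrightarrow> 0) (at 0)"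
    by (rule Lim_null_comparison[OF \<Delta>_le]) (auto intro!: tendsto_eq_intros)
  obtain r where r: "r > 0" "ball ?y r \<subseteq> e -` V"
    using open_eV P0_X_in_eV[OF hz(1-4)] unfolding open_contains_ball by blast
  have seg: "?y + s *\<^sub>R w \<in> e -` V" if "norm w < r" "0 \<le> s" "s \<le> 1" for s w
  proof -
    have "norm (s *\<^sub>R w) \<le> norm w" using that by (simp add: mult_left_le_one_le)
    then have "?y + s *\<^sub>R w \<in> ball ?y r" using that by (simp add: dist_norm)
    then show ?thesis using r by blast
  qed
  have "\<exists>s. 0 < s \<and> s < 1 \<and> L (e (?y + w)) - L (e ?y) = inner (e (A (?y + s *\<^sub>R w))) (e w)"
    if "norm w < r" for w
    using that by (intro L_mean_value seg)
  then obtain \<sigma> where \<sigma>: "\<And>w. norm w < r \<Longrightarrow> 0 < \<sigma> w \<and> \<sigma> w < 1 \<and>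
      L (e (?y + w)) - L (e ?y) = inner (e (A (?y + \<sigma> w *\<^sub>R w))) (e w)"
    by metis
  define a where "a t = A (?y + \<sigma> (\<Delta> t) *\<^sub>R \<Delta> t) - A ?y" for t
  have small: "\<forall>\<^sub>F t in at 0. norm (\<Delta> t) < r"
    using tendstoD[OF \<Delta>_lim r(1)] by (simp add: dist_norm)
  have "((\<lambda>t. \<sigma> (\<Delta> t) *\<^sub>R \<Delta> t) \<longlongrightarrow> 0) (at 0)"
  proof (rule Lim_null_comparison[OF _ tendsto_norm_zero[OF \<Delta>_lim]])
    show "\<forall>\<^sub>F t in at 0. norm (\<sigma> (\<Delta> t) *\<^sub>R \<Delta> t) \<le> norm (\<Delta> t)"
      using small by eventually_elim (use \<sigma> in \<open>simp add: mult_left_le_one_le less_imp_le\<close>)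
  qed
  then have "((\<lambda>t. ?y + \<sigma> (\<Delta> t) *\<^sub>R \<Delta> t) \<longlongrightarrow> ?y + 0) (at 0)" by (intro tendsto_intros)
  moreover have "isCont A (?y + 0)"
    using continuous_on_interior[OF continuous_A] P0_X_in_eV[OF hz(1-4)] interior_open[OF open_eV] by simp
  ultimately have "((\<lambda>t. A (?y + \<sigma> (\<Delta> t) *\<^sub>R \<Delta> t)) \<longlongrightarrow> A (?y + 0)) (at 0)"
    using isCont_tendsto_compose by blast
  then have a_lim: "(a \<longlongrightarrow> 0) (at 0)"
    unfolding a_def[abs_def] using LIM_zero by fastforce
  have quot: "\<forall>\<^sub>F t in at 0. (L_infty e L h (z + t *\<^sub>R u) - L_infty e L h z) /\<^sub>R t
      = inner (e (A ?y)) u + inner (e (a t)) (e (\<Delta> t)) / t"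
    using small K unfolding eventually_at_filter
  proof eventually_elim
    case (elim t)
    show ?case
    proof (intro impI)
      assume t: "t \<noteq> 0"
      have zt: "z + t *\<^sub>R u \<in> ball_infty Binf R" and \<Delta>: "norm (\<Delta> t) < r" using elim t by auto
      note ht = reduction_mapD[OF h zt R]
      have "L_infty e L h (z + t *\<^sub>R u) = L (e (?y + \<Delta> t))"
        using e_P0_X_id[OF hz(1)] e_P0_X_id[OF u]
        by (simp add: L_infty_def \<Delta>_def e.add e.diff e.scaleR algebra_simps)
      moreover have "L_infty e L h z = L (e ?y)"
        using e_P0_X_id[OF hz(1)] by (simp add: L_infty_def e.add)
      ultimately have "L_infty e L h (z + t *\<^sub>R u) - L_infty e L h z
          = inner (e (A (?y + \<sigma> (\<Delta> t) *\<^sub>R \<Delta> t))) (e (\<Delta> t))"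
        using \<sigma>[OF \<Delta>] by simp
      also have "\<dots> = inner (e (A ?y)) (e (\<Delta> t)) + inner (e (a t)) (e (\<Delta> t))"
        by (simp add: a_def e.diff inner_diff_left)
      also have "inner (e (A ?y)) (e (\<Delta> t)) = t * inner (e (A ?y)) u"
      proof -
        have "h (z + t *\<^sub>R u) - h z \<in> Xpm e Binf" using ht(3) hz(3) subspace_diff[OF subspace_Xpm] by blast
        moreover have "e (A ?y) \<in> H0 Binf" using hz(5) ImP0_eq_0_iff by blast
        ultimately have "inner (e (A ?y)) (e (h (z + t *\<^sub>R u) - h z)) = 0" by (intro inner_H0_Xpm)
        then show ?thesis
          using e_P0_X_id[OF u] by (simp add: \<Delta>_def e.add e.scaleR inner_add_right)
      qed
      finally show "(L_infty e L h (z + t *\<^sub>R u) - L_infty e L h z) /\<^sub>R t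
          = inner (e (A ?y)) u + inner (e (a t)) (e (\<Delta> t)) / t"
        using t by (simp add: field_simps)
    qed
  qed
  have "((\<lambda>t. inner (e (a t)) (e (\<Delta> t)) / t) \<longlongrightarrow> 0) (at 0)"
  proof (rule Lim_null_comparison)
    show "\<forall>\<^sub>F t in at 0. norm (inner (e (a t)) (e (\<Delta> t)) / t) \<le> norm (a t) * K'"
      using \<Delta>_le unfolding eventually_at_filter
    proof eventually_elim
      case (elim t)
      show ?case
      proof (intro impI)
        assume t: "t \<noteq> 0"
        have "\<bar>inner (e (a t)) (e (\<Delta> t))\<bar> \<le> norm (e (a t)) * norm (e (\<Delta> t))"
          by (rule Cauchy_Schwarz_ineq2)
        also have "\<dots> \<le> norm (a t) * (K' * \<bar>t\<bar>)"
          using elim t order_trans[OF norm_e_le] by (intro mult_mono norm_e_le) auto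
        finally show "norm (inner (e (a t)) (e (\<Delta> t)) / t) \<le> norm (a t) * K'"
          using t by (simp add: abs_divide pos_divide_le_eq mult.assoc)
      qed
    qed
    show "((\<lambda>t. norm (a t) * K') \<longlongrightarrow> 0) (at 0)"
      by (intro tendsto_mult_left_zero tendsto_norm_zero a_lim)
  qed
  from tendsto_add[OF tendsto_const this]
  have "((\<lambda>t. inner (e (A ?y)) u + inner (e (a t)) (e (\<Delta> t)) / t) \<longlongrightarrow> inner (e (A ?y)) u) (at 0)"
    by simp
  then show ?thesis
    unfolding has_dir_deriv_def
    by (rule Lim_transform_eventually) (use quot in eventually_elim, simp)
qed

text \<open>
  Testing criticality with the direction \<open>u = A(z + h(z))\<close>, which belongs to the kernel, gives
  \<open>A(z + h(z)) = 0\<close>.  Thus the derivative of the functional vanishes on the dense subspace \<open>X\<close>.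
\<close>
lemma critical_point_of_reduced:
  assumes R: "R \<ge> R1" and h: "reduction_map e A Binf \<rho> R h" and z: "z \<in> ball_infty Binf R"
    and crit: "critical_point (H0 Binf) (L_infty e L h) z"
  shows "critical_point UNIV L (z + e (h z))"
proof -
  note hz = reduction_mapD[OF h z R]
  let ?y = "P0_X z + h z"
  have ey: "e ?y = z + e (h z)" using e_P0_X_id[OF hz(1)] by (simp add: e.add)
  have V: "e ?y \<in> V" using P0_X_in_eV[OF hz(1-4)] by simp
  have AH0: "e (A ?y) \<in> H0 Binf" using hz(5) ImP0_eq_0_iff by blast
  have "inner (e (A ?y)) (e (A ?y)) = 0"
    using dir_deriv_eq[OF L_infty_has_dir_deriv[OF R h z AH0]] crit AH0 dir_deriv_eq
    unfolding critical_point_def by metis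
  then have "e (A ?y) = 0" by simp
  then have "dir_deriv L (e ?y) w = 0" if "w \<in> range e" for w
    using that gradient[OF V] by auto
  then have "dir_deriv L (e ?y) u = 0" for u
    by (rule dir_deriv_zero_if_zero_on_dense[OF open_V V continuous_L diff_L dense_e])
  then show ?thesis
    unfolding critical_point_def ey[symmetric] by (metis has_dir_deriv_dir_deriv[OF diff_L V])
qed

end

theorem corollary1p5:
  fixes e :: "'x::banach \<Rightarrow> 'h::{real_inner,banach}"
    and V :: "'h set"
    and L :: "'h \<Rightarrow> real"
    and A :: "'x \<Rightarrow> 'x"
    and B P Q :: "'x \<Rightarrow> 'h \<Rightarrow>\<^sub>L 'h"
    and Binf Pinf Qinf :: "'h \<Rightarrow>\<^sub>L 'h"
    and R1 \<kappa> :: real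
    and \<rho> :: ereal
  assumes "standing_hypotheses e V L A B Binf"
    and "decomposition_hypothesis e V B Binf P Pinf Q Qinf"
    and "dim (H0 Binf) > 0"
    and "strong_contraction e V A Binf R1 \<kappa> \<rho> \<or>
         weak_contraction e V A Binf R1 \<kappa> \<rho> \<and> C1_on (e -` V) A"
  shows "(\<exists>R0\<ge>R1. \<forall>R\<ge>R0. \<exists>h. reduction_map e A Binf \<rho> R h) \<and>
         (\<forall>R\<ge>R1. \<forall>h. reduction_map e A Binf \<rho> R h \<longrightarrow>
            (\<forall>h'. reduction_map e A Binf \<rho> R h' \<longrightarrow> (\<forall>z\<in>ball_infty Binf R. h' z = h z)) \<and>
            (\<forall>z\<in>ball_infty Binf R.
               critical_point (H0 Binf) (L_infty e L h) z \<longrightarrow>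
               critical_point UNIV L (z + e (h z))))"
proof -
  interpret contraction_at_infinity e V L A B P Q Binf Pinf Qinf R1 \<kappa> \<rho>
    using assms weak_contraction_if_strong by unfold_locales blast+
  show ?thesis
    using reduction_map_exists reduction_map_unique critical_point_of_reduced by blast
qed

end
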